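(* Let $(X,T)$ be the compact system described in the context (with fixed $0<\lambda<1$), let $m\ge0$, $D_m(x)=\operatorname{dist}(x,Z_m)$ and $H(u,t)=t$. The sequence $\Phi^{(m)}=\{\phi_n^{(m)}\}_{n\ge1}$ defined by $$\phi_n^{(m)}:=-S_nD_m+(-1)^nH,\qquad n\ge1,$$ is almost additive and orbit Lipschitz (i.e. $D(\Phi^{(m)})<\infty$ and $L_{\rm orb}(\Phi^{(m)})<\infty$), but it is not additive (i.e. it is not true that $\phi^{(m)}_{n+s}=\phi^{(m)}_n+\phi^{(m)}_s\circ T^n$ for all $n,s\ge1$). Its class in $\mathcal E_{\rm orb}(X,T)$ satisfies: (1) $[\Phi^{(m)}]=-[S_\bullet D_m]$; (2) $\mathcal M_{\max}([\Phi^{(m)}])=\{\mu_m\}$; (3) $B_{\mathcal E_{\rm orb}}([\Phi^{(m)}],1)\subset\{\eta\in\mathcal E_{\rm orb}(X,T):\mathcal M_{\max}(\eta)=\{\mu_m\}\}$, where $B_{\mathcal E_{\rm orb}}(\cdot,1)$ is the open unit ball.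
   Context: The system. For $m\ge1$ set $p_m=m+1$, $a_m=2^{-m}$, $Q_m=\{(m,j):j\in\mathbb Z/p_m\mathbb Z\}$; $Q_0=\{\ast\}$; $Y=\{\ast\}\sqcup\bigsqcup_{m\ge1}Q_m$. Put $r(\ast)=0$, $r(m,j)=a_m$, and $d_Y(u,v)=0$ if $u=v$, $d_Y(u,v)=r(u)+r(v)$ if $u\ne v$. $R:Y\to Y$, $R(\ast)=\ast$, $R(m,j)=(m,j+1 \bmod p_m)$. Fix $0<\lambda<1$; $X=Y\times[0,1]$, $d_X((u,t),(v,s))=d_Y(u,v)+|t-s|$, $T(u,t)=(Ru,\lambda t)$. $Z_m=Q_m\times\{0\}$ for $m\ge0$, and $\mu_m$ is the uniform probability measure on the finite set $Z_m$ (a periodic orbit). The space. $S_ng=\sum_{j=0}^{n-1}g\circ T^j$ and $S_\bullet g=\{S_ng\}_{n\ge1}$. $\mathcal A(X,T)$: sequences $\Psi=\{\psi_n\}_{n\ge1}\subset C(X,\mathbb R)$ such that for every $\xi>0$ there is $g\in C(X,\mathbb R)$ with $\limsup_n\frac1n\|\psi_n-S_ng\|_\infty\le\xi$; norm $\|\Psi\|_{\mathcal A}=\sup_n\frac1n\|\psi_n\|_\infty$. $D(\Psi)=\sup_{n,k\ge1}\|\psi_{n+k}-\psi_n-\psi_k\circ T^n\|_\infty$, $L_{\rm orb}(\Psi)=\sup_{n\ge1,x\ne y}|\psi_n(x)-\psi_n(y)|/\sum_{j=0}^{n-1}d_X(T^jx,T^jy)$. $\mathcal{AA}_{\rm orb}(X,T)=\{\Psi\in\mathcal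 A(X,T):D(\Psi),L_{\rm orb}(\Psi)<\infty\}$ with norm $\|\Psi\|_{\mathcal A}+D(\Psi)+L_{\rm orb}(\Psi)$; $\mathcal N=\{\Psi\in\mathcal A(X,T):\lim_n\frac1n\|\psi_n\|_\infty=0\}$; $\mathcal E_{\rm orb}(X,T)=\mathcal{AA}_{\rm orb}(X,T)/(\mathcal{AA}_{\rm orb}(X,T)\cap\mathcal N)$ with quotient norm. $\mathcal M(X,T)$: $T$-invariant Borel probability measures. For $\eta=[\Phi]$, $\eta_*(\mu)=\lim_n\frac1n\int\phi_n\,d\mu$ (well defined), $\mathcal M_{\max}(\eta)=\{\mu\in\mathcal M(X,T):\eta_*(\mu)=\max_\nu\eta_*(\nu)\}$. *)

theory Defs
  imports "HOL-Probability.Probability"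
begin

section \<open>The system\<close>

text \<open>
  The point \<open>(m, j)\<close> of \<open>Q\<^sub>m\<close>, \<open>m \<ge> 1\<close>, is coded by the pair \<open>(m, j)\<close> with \<open>j < p\<^sub>m = m + 1\<close>,
  and the residue class \<open>j\<close> is represented by its least nonnegative representative. The extra
  point \<open>\<star>\<close> is coded by \<open>(0, 0)\<close>, so that \<open>Q\<^sub>0\<close> fits the same pattern; only the radius
  has to distinguish the case \<open>m = 0\<close>.
\<close>

typedef ypt = "{(m, j). j < m + 1} :: (nat \<times> nat) set"
  by auto

definition Q :: "nat \<Rightarrow> ypt set" where
  "Q m = {u. fst (Rep_ypt u) = m}"

definition rad :: "ypt \<Rightarrow> real" where
  "rad u = (if fst (Rep_ypt u) = 0 then 0 else (1 / 2) ^ fst (Rep_ypt u))"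

definition rot :: "ypt \<Rightarrow> ypt" where
  "rot u = (case Rep_ypt u of (m, j) \<Rightarrow> Abs_ypt (m, (j + 1) mod (m + 1)))"

lemma rad_nonneg: "0 \<le> rad u"
  by (simp add: rad_def)

lemma rad_eq_0_iff: "rad u = 0 \<longleftrightarrow> Rep_ypt u = (0, 0)"
  using Rep_ypt[of u] by (auto simp: rad_def split: prod.splits)

lemma rad_add_pos:
  assumes "u \<noteq> v"
  shows "0 < rad u + rad v"
proof (rule ccontr)
  assume "\<not> 0 < rad u + rad v"
  then have "rad u = 0" "rad v = 0"
    using rad_nonneg[of u] rad_nonneg[of v] by linarith+
  then show False
    using assms by (simp add: rad_eq_0_iff flip: Rep_ypt_inject)
qed

instantiation ypt :: metric_space
begin

definition dist_ypt :: "ypt \<Rightarrow> ypt \<Rightarrow> real" where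
  "dist_ypt u v = (if u = v then 0 else rad u + rad v)"

definition uniformity_ypt :: "(ypt \<times> ypt) filter" where
  "uniformity_ypt = (INF e\<in>{0 <..}. principal {(x, y). dist x y < e})"

definition open_ypt :: "ypt set \<Rightarrow> bool" where
  "open_ypt U \<longleftrightarrow> (\<forall>x\<in>U. \<forall>\<^sub>F (x', y) in uniformity. x' = x \<longrightarrow> y \<in> U)"

instance
proof
  fix x y z :: ypt
  show "dist x y = 0 \<longleftrightarrow> x = y"
    using rad_add_pos[of x y] by (auto simp: dist_ypt_def)
  show "dist x y \<le> dist x z + dist y z"
    using rad_nonneg[of x] rad_nonneg[of y] rad_nonneg[of z] by (auto simp: dist_ypt_def)
qed (simp_all add: uniformity_ypt_def open_ypt_def)

end

text \<open>
  \<open>X = Y \<times> [0,1]\<close> gets its own type because the library's metric on a product type is the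
  Euclidean one, whereas \<open>d\<^sub>X\<close> is the sum metric.
\<close>

typedef xpt = "{(u, t). 0 \<le> t \<and> t \<le> 1} :: (ypt \<times> real) set"
  by auto

definition base :: "xpt \<Rightarrow> ypt" where
  "base x = fst (Rep_xpt x)"

definition height :: "xpt \<Rightarrow> real" where
  "height x = snd (Rep_xpt x)"

instantiation xpt :: metric_space
begin

definition dist_xpt :: "xpt \<Rightarrow> xpt \<Rightarrow> real" where
  "dist_xpt x y = dist (base x) (base y) + \<bar>height x - height y\<bar>"

definition uniformity_xpt :: "(xpt \<times> xpt) filter" where
  "uniformity_xpt = (INF e\<in>{0 <..}. principal {(x, y). dist x y < e})"

definition open_xpt :: "xpt set \<Rightarrow> bool" where
  "open_xpt U \<longleftrightarrow> (\<forall>x\<in>U. \<forall>\<^sub>F (x', y) in uniformity. x' = x \<longrightarrow> y \<in> U)"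

instance
proof
  fix x y z :: xpt
  show "dist x y = 0 \<longleftrightarrow> x = y"
    by (auto simp: dist_xpt_def base_def height_def add_nonneg_eq_0_iff prod_eq_iff
        simp flip: Rep_xpt_inject)
  show "dist x y \<le> dist x z + dist y z"
    using dist_triangle2[of "base x" "base y" "base z"] by (auto simp: dist_xpt_def)
qed (simp_all add: uniformity_xpt_def open_xpt_def)

end

text \<open>\<open>T lam\<close> is meaningful for \<open>0 \<le> lam \<le> 1\<close>, where the argument of \<open>Abs_xpt\<close> lies in \<open>X\<close>.\<close>

definition T :: "real \<Rightarrow> xpt \<Rightarrow> xpt" where
  "T lam x = Abs_xpt (rot (base x), lam * height x)"

definition Z :: "nat \<Rightarrow> xpt set" where
  "Z m = {x. base x \<in> Q m \<and> height x = 0}"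

definition mu :: "nat \<Rightarrow> xpt measure" where
  "mu m = distr (uniform_count_measure (Z m)) borel (\<lambda>x. x)"


section \<open>Sequences of continuous functions\<close>

text \<open>
  Norms and seminorms take values in \<^typ>\<open>ennreal\<close>, so that every supremum below is the true one.
  A sequence \<open>{\<psi>\<^sub>n}\<close>, \<open>n \<ge> 1\<close>, is a function on \<^typ>\<open>nat\<close> whose unused value at \<open>0\<close> is
  normalised to \<open>0\<close>. Negation and difference of sequences are the library's pointwise ones.
\<close>

definition sup_norm :: "(xpt \<Rightarrow> real) \<Rightarrow> ennreal" where
  "sup_norm f = (SUP x. ennreal \<bar>f x\<bar>)"

definition birkhoff :: "real \<Rightarrow> (xpt \<Rightarrow> real) \<Rightarrow> nat \<Rightarrow> xpt \<Rightarrow> real" where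
  "birkhoff lam g n = (\<lambda>x. \<Sum>j<n. g ((T lam ^^ j) x))"

definition A_space :: "real \<Rightarrow> (nat \<Rightarrow> xpt \<Rightarrow> real) set" where
  "A_space lam = {\<Psi>. \<Psi> 0 = (\<lambda>_. 0) \<and> (\<forall>n\<ge>1. continuous_on UNIV (\<Psi> n)) \<and>
     (\<forall>\<xi>>0. \<exists>g. continuous_on UNIV g \<and>
        limsup (\<lambda>n. sup_norm (\<Psi> n - birkhoff lam g n) / of_nat n) \<le> ennreal \<xi>)}"

definition A_norm :: "(nat \<Rightarrow> xpt \<Rightarrow> real) \<Rightarrow> ennreal" where
  "A_norm \<Psi> = (SUP n\<in>{1..}. sup_norm (\<Psi> n) / of_nat n)"

definition defect :: "real \<Rightarrow> (nat \<Rightarrow> xpt \<Rightarrow> real) \<Rightarrow> ennreal" where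
  "defect lam \<Psi> = (SUP n\<in>{1..}. SUP k\<in>{1..}.
     sup_norm (\<lambda>x. \<Psi> (n + k) x - \<Psi> n x - \<Psi> k ((T lam ^^ n) x)))"

definition L_orb :: "real \<Rightarrow> (nat \<Rightarrow> xpt \<Rightarrow> real) \<Rightarrow> ennreal" where
  "L_orb lam \<Psi> = (SUP n\<in>{1..}. SUP (x, y)\<in>{(x, y). x \<noteq> y}.
     ennreal (\<bar>\<Psi> n x - \<Psi> n y\<bar> / (\<Sum>j<n. dist ((T lam ^^ j) x) ((T lam ^^ j) y))))"

definition AA_orb :: "real \<Rightarrow> (nat \<Rightarrow> xpt \<Rightarrow> real) set" where
  "AA_orb lam = {\<Psi> \<in> A_space lam. defect lam \<Psi> < \<infinity> \<and> L_orb lam \<Psi> < \<infinity>}"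

definition AA_norm :: "real \<Rightarrow> (nat \<Rightarrow> xpt \<Rightarrow> real) \<Rightarrow> ennreal" where
  "AA_norm lam \<Psi> = A_norm \<Psi> + defect lam \<Psi> + L_orb lam \<Psi>"

definition null_space :: "real \<Rightarrow> (nat \<Rightarrow> xpt \<Rightarrow> real) set" where
  "null_space lam = {\<Psi> \<in> A_space lam. (\<lambda>n. sup_norm (\<Psi> n) / of_nat n) \<longlonglongrightarrow> 0}"


section \<open>The quotient space\<close>

text \<open>
  Elements of the quotient are the cosets themselves. The operations on cosets are written out
  because \<open>-\<close> on sets denotes complement and set difference.
\<close>

definition E_rel :: "real \<Rightarrow> ((nat \<Rightarrow> xpt \<Rightarrow> real) \<times> (nat \<Rightarrow> xpt \<Rightarrow> real)) set" where
  "E_rel lam = {(\<Psi>, \<Phi>). \<Psi> \<in> AA_orb lam \<and> \<Phi> \<in> AA_orb lam \<and>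
     \<Psi> - \<Phi> \<in> AA_orb lam \<inter> null_space lam}"

definition E_orb :: "real \<Rightarrow> (nat \<Rightarrow> xpt \<Rightarrow> real) set set" where
  "E_orb lam = AA_orb lam // E_rel lam"

definition E_class :: "real \<Rightarrow> (nat \<Rightarrow> xpt \<Rightarrow> real) \<Rightarrow> (nat \<Rightarrow> xpt \<Rightarrow> real) set" where
  "E_class lam \<Psi> = E_rel lam `` {\<Psi>}"

definition E_uminus :: "(nat \<Rightarrow> xpt \<Rightarrow> real) set \<Rightarrow> (nat \<Rightarrow> xpt \<Rightarrow> real) set" where
  "E_uminus \<eta> = {- \<Psi> | \<Psi>. \<Psi> \<in> \<eta>}"

definition E_minus ::
    "(nat \<Rightarrow> xpt \<Rightarrow> real) set \<Rightarrow> (nat \<Rightarrow> xpt \<Rightarrow> real) set \<Rightarrow> (nat \<Rightarrow> xpt \<Rightarrow> real) set" where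
  "E_minus \<eta> \<zeta> = {\<Psi> - \<Phi> | \<Psi> \<Phi>. \<Psi> \<in> \<eta> \<and> \<Phi> \<in> \<zeta>}"

definition E_norm :: "real \<Rightarrow> (nat \<Rightarrow> xpt \<Rightarrow> real) set \<Rightarrow> ennreal" where
  "E_norm lam \<eta> = (INF \<Psi>\<in>\<eta>. AA_norm lam \<Psi>)"

definition E_ball :: "real \<Rightarrow> (nat \<Rightarrow> xpt \<Rightarrow> real) set \<Rightarrow> real \<Rightarrow> (nat \<Rightarrow> xpt \<Rightarrow> real) set set" where
  "E_ball lam \<zeta> \<epsilon> = {\<eta> \<in> E_orb lam. E_norm lam (E_minus \<eta> \<zeta>) < ennreal \<epsilon>}"


section \<open>Maximizing measures\<close>

definition inv_measures :: "real \<Rightarrow> xpt measure set" where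
  "inv_measures lam = {\<mu>. prob_space \<mu> \<and> sets \<mu> = sets borel \<and> distr \<mu> borel (T lam) = \<mu>}"

text \<open>The common value of \<open>lim (1/n) \<integral> \<phi>\<^sub>n d\<mu>\<close> over all representatives of the class.\<close>

definition E_eval :: "(nat \<Rightarrow> xpt \<Rightarrow> real) set \<Rightarrow> xpt measure \<Rightarrow> real" where
  "E_eval \<eta> \<mu> = (THE c. \<forall>\<Phi>\<in>\<eta>. (\<lambda>n. (LINT x|\<mu>. \<Phi> n x) / real n) \<longlonglongrightarrow> c)"

definition M_max :: "real \<Rightarrow> (nat \<Rightarrow> xpt \<Rightarrow> real) set \<Rightarrow> xpt measure set" where
  "M_max lam \<eta> = {\<mu> \<in> inv_measures lam. \<forall>\<nu>\<in>inv_measures lam. E_eval \<eta> \<nu> \<le> E_eval \<eta> \<mu>}"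


section \<open>The non-additive sequence\<close>

definition D_fun :: "nat \<Rightarrow> xpt \<Rightarrow> real" where
  "D_fun m x = infdist x (Z m)"

definition Phi :: "real \<Rightarrow> nat \<Rightarrow> nat \<Rightarrow> xpt \<Rightarrow> real" where
  "Phi lam m n = (if n = 0 then (\<lambda>_. 0)
     else (\<lambda>x. - birkhoff lam (D_fun m) n x + (- 1) ^ n * height x))"

end

theory Submission
  imports Defs
begin

text \<open>
  A point \<open>x\<close> is shadowed by a point \<open>y\<close> of \<open>Z\<^sub>m\<close> with
  \<open>d\<^sub>X(T\<^sup>jx, T\<^sup>jy) \<le> D\<^sub>m(T\<^sup>jx)\<close> for all \<open>j\<close>. If a class \<open>\<eta>\<close> lies in the unit ball around
  \<open>[\<Phi>]\<close>, then the difference \<open>\<Theta>\<close> of suitable representatives has orbit Lipschitz constant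
  \<open>L < 1\<close>, so \<open>\<theta>\<^sub>n(x) \<le> \<theta>\<^sub>n(y) + L S\<^sub>nD\<^sub>m(x)\<close>. By almost additivity \<open>\<theta>\<^sub>n\<close> oscillates by a
  bounded amount on the periodic orbit \<open>Z\<^sub>m\<close>; integrating against an invariant \<open>\<nu>\<close> and dividing by
  \<open>n\<close> gives \<open>\<eta>\<^sub>*(\<nu>) \<le> \<eta>\<^sub>*(\<mu>\<^sub>m) - (1 - L) \<integral>D\<^sub>m d\<nu>\<close>. The integral vanishes only if \<open>\<nu>\<close> is carried by
  \<open>Z\<^sub>m\<close>, and then \<open>\<nu> = \<mu>\<^sub>m\<close> by invariance.
\<close>

section \<open>The dynamics\<close>

lemma base_eq_height_eq_imp_eq: "base x = base y \<Longrightarrow> height x = height y \<Longrightarrow> x = y"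
  by (simp add: base_def height_def prod_eq_iff flip: Rep_xpt_inject)

lemma height_nonneg: "0 \<le> height x" and height_le_1: "height x \<le> 1"
  using Rep_xpt[of x] by (auto simp: height_def)

lemma Rep_rot: "Rep_ypt (rot u) = (fst (Rep_ypt u), Suc (snd (Rep_ypt u)) mod Suc (fst (Rep_ypt u)))"
  by (simp add: rot_def Abs_ypt_inverse split: prod.splits)

lemma Rep_rot_pow:
  "Rep_ypt ((rot ^^ k) u) = (fst (Rep_ypt u), (snd (Rep_ypt u) + k) mod Suc (fst (Rep_ypt u)))"
proof (induction k)
  case 0
  \<comment> \<open>The type invariant \<open>j < m + 1\<close> makes the stored residue already
    reduced modulo \<open>Suc m\<close>.\<close>
  then show ?case using Rep_ypt[of u] by (auto simp: prod_eq_iff split: prod.splits)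
next
  case (Suc k)
  then show ?case by (simp add: Rep_rot mod_simps)
qed

lemma rad_rot [simp]: "rad (rot u) = rad u"
  by (simp add: rad_def Rep_rot)

lemma rot_in_Q_iff [simp]: "rot u \<in> Q m \<longleftrightarrow> u \<in> Q m"
  by (simp add: Q_def Rep_rot)

text \<open>Every \<open>Q m\<close> is a single cycle. The lower bound on \<open>k\<close> lets it
  serve as a time index of sequences starting at 1 and forces genuine returns; the upper bound keeps
  later constants independent of the points.\<close>

lemma rot_transitive_Q:
  assumes "u \<in> Q m" "v \<in> Q m"
  obtains k where "1 \<le> k" "k \<le> Suc m" "(rot ^^ k) u = v"
proof -
  obtain i where i: "Rep_ypt u = (m, i)" "i < Suc m"
    using assms(1) Rep_ypt[of u] by (cases "Rep_ypt u") (auto simp: Q_def)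
  obtain j where j: "Rep_ypt v = (m, j)" "j < Suc m"
    using assms(2) Rep_ypt[of v] by (cases "Rep_ypt v") (auto simp: Q_def)
  \<comment> \<open>For \<open>i = j\<close> the second branch gives the full turn
    \<open>Suc m\<close> instead of 0.\<close>
  define k where "k = (if i < j then j - i else Suc m + j - i)"
  have "(i + k) mod Suc m = j"
  proof (cases "i < j")
    case False
    then have "i + k = j + Suc m" using i(2) by (simp add: k_def)
    then show ?thesis using j(2) by (simp only: mod_add_self2 mod_less)
  qed (use j(2) in \<open>simp add: k_def\<close>)
  then have "(rot ^^ k) u = v"
    using i j by (simp add: Rep_rot_pow flip: Rep_ypt_inject)
  moreover have "1 \<le> k" "k \<le> Suc m" using i(2) j(2) by (auto simp: k_def)
  ultimately show ?thesis using that by blast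
qed

lemma Q_eq: "Q m = (\<lambda>j. Abs_ypt (m, j)) ` {..m}"
proof (intro equalityI subsetI)
  fix u assume "u \<in> Q m"
  then have "u = Abs_ypt (m, snd (Rep_ypt u))" "snd (Rep_ypt u) \<le> m"
    using Rep_ypt[of u] Rep_ypt_inverse[of u] by (auto simp: Q_def split: prod.splits)
  then show "u \<in> (\<lambda>j. Abs_ypt (m, j)) ` {..m}" by blast
qed (auto simp: Q_def Abs_ypt_inverse)

lemma finite_Q: "finite (Q m)"
  by (simp add: Q_eq)

lemma Q_nonempty: "Q m \<noteq> {}"
  by (simp add: Q_eq)

section \<open>Metric bounds on \<open>X\<close> and the distance to \<open>Z m\<close>\<close>

lemma rad_le_half: "rad u \<le> 1 / 2"
proof (cases "fst (Rep_ypt u)")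
  case (Suc k)
  have "(1 / 2 :: real) ^ k \<le> 1" by (simp add: power_le_one)
  with Suc show ?thesis by (simp add: rad_def)
qed (simp add: rad_def)

text \<open>Two radii of at most 1/2 and a height difference of at most 1. This diameter bound takes
  the place of compactness in the boundedness arguments below.\<close>

lemma dist_xpt_le_2: "dist x y \<le> 2" for x y :: xpt
  using rad_le_half[of "base x"] rad_le_half[of "base y"] rad_nonneg[of "base x"]
    rad_nonneg[of "base y"] height_nonneg[of x] height_nonneg[of y] height_le_1[of x] height_le_1[of y]
  by (auto simp: dist_xpt_def dist_ypt_def)

lemma height_diff_le_dist: "\<bar>height x - height y\<bar> \<le> dist x y"
  by (simp add: dist_xpt_def)

lemma continuous_height: "continuous_on UNIV height"
  unfolding continuous_on_iff
  using height_diff_le_dist by (metis dist_real_def le_less_trans)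

lemma Z_eq: "Z m = (\<lambda>u. Abs_xpt (u, 0)) ` Q m"
proof (intro equalityI subsetI)
  fix x assume "x \<in> Z m"
  then have "x = Abs_xpt (base x, 0)" "base x \<in> Q m"
    using Rep_xpt_inverse[of x] by (auto simp: Z_def base_def height_def prod_eq_iff)
      (metis prod.collapse)
  then show "x \<in> (\<lambda>u. Abs_xpt (u, 0)) ` Q m" by blast
qed (auto simp: Z_def base_def height_def Abs_xpt_inverse)

lemma finite_Z: "finite (Z m)"
  by (simp add: Z_eq finite_Q)

lemma Z_nonempty: "Z m \<noteq> {}"
  by (simp add: Z_eq Q_nonempty)

lemma D_fun_lipschitz: "\<bar>D_fun m x - D_fun m y\<bar> \<le> dist x y"
  by (simp add: D_fun_def infdist_triangle_abs)

lemma continuous_D_fun: "continuous_on UNIV (D_fun m)"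
  unfolding D_fun_def by (intro continuous_intros)

lemma D_fun_nonneg: "0 \<le> D_fun m x"
  by (simp add: D_fun_def infdist_nonneg)

lemma D_fun_eq_0_iff: "D_fun m x = 0 \<longleftrightarrow> x \<in> Z m"
  unfolding D_fun_def
  using in_closed_iff_infdist_zero[OF finite_imp_closed[OF finite_Z] Z_nonempty] by simp

text \<open>Over \<open>Q m\<close> the nearest point of \<open>Z m\<close> lies vertically below
  \<open>x\<close>. Elsewhere the base distance to a point of \<open>Z m\<close> is the sum of the
  two radii, so all points of \<open>Z m\<close> are equally far away.\<close>

lemma dist_le_D_fun:
  assumes "y \<in> Z m" "base x \<in> Q m \<Longrightarrow> base y = base x"
  shows "dist x y \<le> D_fun m x"
proof -
  have "dist x y \<le> dist x z" if "z \<in> Z m" for z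
  proof (cases "base x \<in> Q m")
    case True
    then show ?thesis using assms that by (simp add: dist_xpt_def Z_def)
  next
    case False
    then have "base x \<noteq> base z" using that by (auto simp: Z_def)
    \<comment> \<open>Both points lie over \<open>Q m\<close>, and \<open>rad\<close> depends only
      on the first index.\<close>
    moreover have "rad (base z) = rad (base y)"
      using assms(1) that by (simp add: Z_def Q_def rad_def)
    ultimately have "dist (base x) (base y) \<le> dist (base x) (base z)"
      by (simp add: dist_ypt_def rad_nonneg)
    then show ?thesis
      using assms(1) that by (simp add: dist_xpt_def Z_def)
  qed
  then show ?thesis
    using Z_nonempty by (auto simp: D_fun_def infdist_notempty intro!: cINF_greatest)
qed

section \<open>Orbits of \<open>T lam\<close> and Birkhoff sums\<close>

context
  fixes lam :: real
  assumes lam: "0 < lam" "lam < 1"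
begin

lemma Rep_T: "Rep_xpt (T lam x) = (rot (base x), lam * height x)"
  using lam height_nonneg[of x] height_le_1[of x]
  by (simp add: T_def Abs_xpt_inverse mult_le_one)

lemma base_T: "base (T lam x) = rot (base x)"
  by (simp add: base_def Rep_T)

lemma height_T: "height (T lam x) = lam * height x"
  by (simp add: height_def Rep_T)

lemma base_T_pow: "base ((T lam ^^ k) x) = (rot ^^ k) (base x)"
  by (induction k) (simp_all add: base_T)

lemma height_T_pow: "height ((T lam ^^ k) x) = lam ^ k * height x"
  by (induction k) (simp_all add: height_T)

lemma rot_pow_in_Q_iff: "(rot ^^ k) u \<in> Q m \<longleftrightarrow> u \<in> Q m"
  by (induction k) simp_all

lemma T_pow_in_Z: "x \<in> Z m \<Longrightarrow> (T lam ^^ k) x \<in> Z m"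
  by (simp add: Z_def base_T_pow height_T_pow rot_pow_in_Q_iff)

lemma T_in_Z: "x \<in> Z m \<Longrightarrow> T lam x \<in> Z m"
  using T_pow_in_Z[of x m 1] by simp

text \<open>Heights on \<open>Z m\<close> vanish and stay zero, so transitivity is inherited from
  \<open>rot\<close> on \<open>Q m\<close>.\<close>

lemma T_transitive_Z:
  assumes "x \<in> Z m" "y \<in> Z m"
  obtains k where "1 \<le> k" "k \<le> Suc m" "(T lam ^^ k) x = y"
proof -
  obtain k where k: "1 \<le> k" "k \<le> Suc m" "(rot ^^ k) (base x) = base y"
    using rot_transitive_Q assms unfolding Z_def by blast
  then have "(T lam ^^ k) x = y"
    using assms by (intro base_eq_height_eq_imp_eq) (simp_all add: base_T_pow height_T_pow Z_def)
  with k that show ?thesis by blast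
qed

text \<open>\<open>rot\<close> preserves radii and heights are scaled by \<open>lam < 1\<close>.
  Continuity of \<open>T lam\<close> follows.\<close>

lemma dist_T_le: "dist (T lam x) (T lam y) \<le> dist x y"
proof -
  have "dist (rot (base x)) (rot (base y)) \<le> dist (base x) (base y)"
    by (auto simp: dist_ypt_def rad_nonneg)
  moreover have "\<bar>lam * height x - lam * height y\<bar> \<le> 1 * \<bar>height x - height y\<bar>"
    using lam by (simp add: abs_mult mult_left_le_one_le flip: right_diff_distrib)
  ultimately show ?thesis by (simp add: dist_xpt_def base_T height_T)
qed

lemma continuous_T: "continuous_on UNIV (T lam)"
  unfolding continuous_on_iff using dist_T_le by (metis le_less_trans)

lemma continuous_T_pow: "continuous_on UNIV (T lam ^^ k)"
proof (induction k)
  case (Suc k)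
  then show ?case
    using continuous_on_compose[OF Suc continuous_on_subset[OF continuous_T subset_UNIV]]
    by simp
qed (simp add: continuous_on_id id_def)

lemma T_measurable: "T lam \<in> borel_measurable borel"
  by (intro borel_measurable_continuous_onI continuous_T)

lemma continuous_birkhoff:
  "continuous_on UNIV g \<Longrightarrow> continuous_on UNIV (birkhoff lam g n)"
  unfolding birkhoff_def
  by (intro continuous_intros continuous_on_compose2[OF _ continuous_T_pow]) auto

text \<open>The cocycle identity: Birkhoff sums are exactly additive, hence have zero
  defect.\<close>

lemma birkhoff_add_index:
  "birkhoff lam g (n + k) x = birkhoff lam g n x + birkhoff lam g k ((T lam ^^ n) x)"
proof -
  have "(\<Sum>j<n + k. g ((T lam ^^ j) x))
      = (\<Sum>j<n. g ((T lam ^^ j) x)) + (\<Sum>j<k. g ((T lam ^^ (n + j)) x))"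
    by (induction k) simp_all
  also have "(\<Sum>j<k. g ((T lam ^^ (n + j)) x)) = (\<Sum>j<k. g ((T lam ^^ j) ((T lam ^^ n) x)))"
    by (subst add.commute) (simp add: funpow_add)
  finally show ?thesis by (simp add: birkhoff_def)
qed

text \<open>Outside \<open>Q\<^sub>m\<close> every point of \<open>Z\<^sub>m\<close> is a nearest one, so a nearest point can be chosen
  once and for all along the whole orbit.\<close>

lemma shadowing_point:
  obtains y where "y \<in> Z m"
    and "\<And>n. (\<Sum>j<n. dist ((T lam ^^ j) x) ((T lam ^^ j) y)) \<le> birkhoff lam (D_fun m) n x"
proof -
  obtain z where z: "z \<in> Z m" using Z_nonempty by blast
  define y where "y = (if base x \<in> Q m then Abs_xpt (base x, 0) else z)"
  have y: "y \<in> Z m" "base x \<in> Q m \<Longrightarrow> base y = base x"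
    using z by (auto simp: y_def Z_eq base_def Abs_xpt_inverse)
  have "dist ((T lam ^^ j) x) ((T lam ^^ j) y) \<le> D_fun m ((T lam ^^ j) x)" for j
    using y by (intro dist_le_D_fun T_pow_in_Z) (auto simp: base_T_pow rot_pow_in_Q_iff)
  then show ?thesis using that[of y] y(1) by (simp add: birkhoff_def sum_mono)
qed

end

section \<open>The function spaces\<close>

lemma sup_norm_le_iff: "0 \<le> c \<Longrightarrow> sup_norm f \<le> ennreal c \<longleftrightarrow> (\<forall>x. \<bar>f x\<bar> \<le> c)"
  by (simp add: sup_norm_def SUP_le_iff)

lemma divide_of_nat_le_ennreal_iff:
  assumes "0 < n" "0 \<le> c"
  shows "(a :: ennreal) / of_nat n \<le> ennreal c \<longleftrightarrow> a \<le> ennreal (c * real n)"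
proof (cases a)
  case (real r)
  then show ?thesis
    using assms by (simp add: ennreal_of_nat_eq_real_of_nat divide_ennreal field_simps)
next
  case top
  then show ?thesis
    using assms by (simp add: ennreal_of_nat_eq_real_of_nat ennreal_top_divide top_unique)
qed

lemma sup_norm_div_le_iff:
  "0 < n \<Longrightarrow> 0 \<le> c \<Longrightarrow> sup_norm f / of_nat n \<le> ennreal c \<longleftrightarrow> (\<forall>x. \<bar>f x\<bar> \<le> c * real n)"
  by (simp add: divide_of_nat_le_ennreal_iff sup_norm_le_iff)

text \<open>For a fixed \<open>\<xi>\<close> the limsup bound and the eventual pointwise bound
  differ, but passing from one to the other costs at most a factor 2, which disappears because
  \<open>\<xi>\<close> ranges over all positive reals.\<close>

lemma A_space_iff:
  "\<Psi> \<in> A_space lam \<longleftrightarrow> \<Psi> 0 = (\<lambda>_. 0) \<and> (\<forall>n\<ge>1. continuous_on UNIV (\<Psi> n)) \<and>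
    (\<forall>\<xi>>0. \<exists>g. continuous_on UNIV g \<and>
      (\<forall>\<^sub>F n in sequentially. \<forall>x. \<bar>\<Psi> n x - birkhoff lam g n x\<bar> \<le> \<xi> * real n))"
proof -
  have ev: "(\<forall>\<^sub>F n in sequentially. \<forall>x. \<bar>\<Psi> n x - birkhoff lam g n x\<bar> \<le> \<xi> * real n) \<longleftrightarrow>
    (\<forall>\<^sub>F n in sequentially. sup_norm (\<Psi> n - birkhoff lam g n) / of_nat n \<le> ennreal \<xi>)"
    if "0 < \<xi>" for \<xi> g
    using that by (intro eventually_cong[OF eventually_gt_at_top[of 0]])
      (simp add: sup_norm_div_le_iff)
  have 1: "(\<forall>\<^sub>F n in sequentially. \<forall>x. \<bar>\<Psi> n x - birkhoff lam g n x\<bar> \<le> 2 * \<xi> * real n)"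
    if "0 < \<xi>" "limsup (\<lambda>n. sup_norm (\<Psi> n - birkhoff lam g n) / of_nat n) \<le> ennreal \<xi>" for \<xi> g
  proof -
    \<comment> \<open>Only a strict inequality for the limsup yields an eventual bound, hence the
      doubling.\<close>
    have "limsup (\<lambda>n. sup_norm (\<Psi> n - birkhoff lam g n) / of_nat n) < ennreal (2 * \<xi>)"
      using that by (auto intro: le_less_trans simp: ennreal_less_iff)
    then show ?thesis
      using that by (subst ev) (auto dest!: Limsup_lessD elim: eventually_mono)
  qed
  have 2: "limsup (\<lambda>n. sup_norm (\<Psi> n - birkhoff lam g n) / of_nat n) \<le> ennreal \<xi>"
    if "0 < \<xi>" "(\<forall>\<^sub>F n in sequentially. \<forall>x. \<bar>\<Psi> n x - birkhoff lam g n x\<bar> \<le> \<xi> * real n)" for \<xi> g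
    using that by (subst (asm) ev) (auto intro: Limsup_bounded)
  have "(\<forall>\<xi>>0. \<exists>g. continuous_on UNIV g \<and>
        limsup (\<lambda>n. sup_norm (\<Psi> n - birkhoff lam g n) / of_nat n) \<le> ennreal \<xi>) \<longleftrightarrow>
      (\<forall>\<xi>>0. \<exists>g. continuous_on UNIV g \<and>
        (\<forall>\<^sub>F n in sequentially. \<forall>x. \<bar>\<Psi> n x - birkhoff lam g n x\<bar> \<le> \<xi> * real n))"
    (is "?l \<longleftrightarrow> ?r")
  proof
    assume l: ?l
    show ?r
    proof (intro allI impI)
      fix \<xi> :: real assume "0 < \<xi>"
      then obtain g where "continuous_on UNIV g"
          "limsup (\<lambda>n. sup_norm (\<Psi> n - birkhoff lam g n) / of_nat n) \<le> ennreal (\<xi> / 2)"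
        using l half_gt_zero by blast
      with 1[of "\<xi> / 2" g] \<open>0 < \<xi>\<close> show "\<exists>g. continuous_on UNIV g \<and>
        (\<forall>\<^sub>F n in sequentially. \<forall>x. \<bar>\<Psi> n x - birkhoff lam g n x\<bar> \<le> \<xi> * real n)"
        by auto
    qed
  qed (use 2 in blast)
  then show ?thesis by (simp add: A_space_def)
qed

lemma null_space_iff:
  "\<Psi> \<in> null_space lam \<longleftrightarrow> \<Psi> \<in> A_space lam \<and>
    (\<forall>\<xi>>0. \<forall>\<^sub>F n in sequentially. \<forall>x. \<bar>\<Psi> n x\<bar> \<le> \<xi> * real n)"
proof -
  have ev: "(\<forall>\<^sub>F n in sequentially. \<forall>x. \<bar>\<Psi> n x\<bar> \<le> \<xi> * real n) \<longleftrightarrow>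
    (\<forall>\<^sub>F n in sequentially. sup_norm (\<Psi> n) / of_nat n \<le> ennreal \<xi>)"
    if "0 < \<xi>" for \<xi>
    using that by (intro eventually_cong[OF eventually_gt_at_top[of 0]])
      (simp add: sup_norm_div_le_iff)
  have "(\<lambda>n. sup_norm (\<Psi> n) / of_nat n) \<longlonglongrightarrow> 0 \<longleftrightarrow>
      (\<forall>\<xi>>0. \<forall>\<^sub>F n in sequentially. sup_norm (\<Psi> n) / of_nat n \<le> ennreal \<xi>)" (is "?l \<longleftrightarrow> ?r")
  proof
    assume ?l
    show ?r
    proof (intro allI impI)
      fix \<xi> :: real assume "0 < \<xi>"
      then have "0 < ennreal \<xi>" by simp
      from order_tendstoD(2)[OF \<open>?l\<close> this]
      show "\<forall>\<^sub>F n in sequentially. sup_norm (\<Psi> n) / of_nat n \<le> ennreal \<xi>"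
        by (rule eventually_mono) (rule less_imp_le)
    qed
  next
    assume r: ?r
    show ?l
    proof (rule tendsto_zero_ennreal)
      fix \<xi> :: real assume "0 < \<xi>"
      then have "\<forall>\<^sub>F n in sequentially. sup_norm (\<Psi> n) / of_nat n \<le> ennreal (\<xi> / 2)"
        using r by simp
      then show "\<forall>\<^sub>F n in sequentially. sup_norm (\<Psi> n) / of_nat n < ennreal \<xi>"
        using \<open>0 < \<xi>\<close> by (auto elim!: eventually_mono intro: le_less_trans simp: ennreal_less_iff)
    qed
  qed
  with ev show ?thesis by (simp add: null_space_def)
qed

lemma ennreal_finite_bound_iff:
  "(a :: ennreal) < \<infinity> \<longleftrightarrow> (\<exists>C\<ge>0. a \<le> ennreal C)"
  by (cases a) (auto simp: less_top top_unique)

lemma defect_le_iff: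
  "0 \<le> C \<Longrightarrow> defect lam \<Psi> \<le> ennreal C \<longleftrightarrow>
    (\<forall>n\<ge>1. \<forall>k\<ge>1. \<forall>x. \<bar>\<Psi> (n + k) x - \<Psi> n x - \<Psi> k ((T lam ^^ n) x)\<bar> \<le> C)"
  by (auto simp: defect_def SUP_le_iff sup_norm_le_iff)

text \<open>The left side is the summand \<open>j = 0\<close>. Thus the denominators in
  \<open>L_orb\<close> are positive for distinct points, and ordinary Lipschitz bounds imply orbit
  Lipschitz ones.\<close>

lemma dist_le_orbit_sum:
  "1 \<le> n \<Longrightarrow> dist x y \<le> (\<Sum>j<n. dist ((T lam ^^ j) x) ((T lam ^^ j) y))"
  using member_le_sum[of 0 "{..<n}" "\<lambda>j. dist ((T lam ^^ j) x) ((T lam ^^ j) y)"] by simp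

text \<open>The positive denominator is cleared; the diagonal can then be included, since both sides
  vanish there.\<close>

lemma L_orb_le_iff:
  assumes "0 \<le> L"
  shows "L_orb lam \<Psi> \<le> ennreal L \<longleftrightarrow> (\<forall>n\<ge>1. \<forall>x y.
    \<bar>\<Psi> n x - \<Psi> n y\<bar> \<le> L * (\<Sum>j<n. dist ((T lam ^^ j) x) ((T lam ^^ j) y)))"
proof -
  have "ennreal (\<bar>\<Psi> n x - \<Psi> n y\<bar> / (\<Sum>j<n. dist ((T lam ^^ j) x) ((T lam ^^ j) y))) \<le> ennreal L
    \<longleftrightarrow> \<bar>\<Psi> n x - \<Psi> n y\<bar> \<le> L * (\<Sum>j<n. dist ((T lam ^^ j) x) ((T lam ^^ j) y))"
    if "1 \<le> n" "x \<noteq> y" for n x y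
  proof -
    have "0 < (\<Sum>j<n. dist ((T lam ^^ j) x) ((T lam ^^ j) y))"
      using dist_le_orbit_sum[OF that(1), of x y lam] that(2)
      by (metis less_le_trans zero_less_dist_iff)
    then show ?thesis using assms by (simp add: pos_divide_le_eq)
  qed
  then have "L_orb lam \<Psi> \<le> ennreal L \<longleftrightarrow> (\<forall>n\<ge>1. \<forall>x y. x \<noteq> y \<longrightarrow>
    \<bar>\<Psi> n x - \<Psi> n y\<bar> \<le> L * (\<Sum>j<n. dist ((T lam ^^ j) x) ((T lam ^^ j) y)))"
    unfolding L_orb_def SUP_le_iff by auto
  also have "\<dots> \<longleftrightarrow> (\<forall>n\<ge>1. \<forall>x y.
    \<bar>\<Psi> n x - \<Psi> n y\<bar> \<le> L * (\<Sum>j<n. dist ((T lam ^^ j) x) ((T lam ^^ j) y)))"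
  proof (intro iffI allI impI)
    fix n :: nat and x y
    assume "\<forall>n\<ge>1. \<forall>x y. x \<noteq> y \<longrightarrow>
      \<bar>\<Psi> n x - \<Psi> n y\<bar> \<le> L * (\<Sum>j<n. dist ((T lam ^^ j) x) ((T lam ^^ j) y))" "1 \<le> n"
    then show "\<bar>\<Psi> n x - \<Psi> n y\<bar> \<le> L * (\<Sum>j<n. dist ((T lam ^^ j) x) ((T lam ^^ j) y))"
      by (cases "x = y") simp_all
  qed blast
  finally show ?thesis .
qed

lemma AA_orb_iff:
  "\<Psi> \<in> AA_orb lam \<longleftrightarrow> \<Psi> \<in> A_space lam \<and>
    (\<exists>C\<ge>0. \<forall>n\<ge>1. \<forall>k\<ge>1. \<forall>x. \<bar>\<Psi> (n + k) x - \<Psi> n x - \<Psi> k ((T lam ^^ n) x)\<bar> \<le> C) \<and>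
    (\<exists>L\<ge>0. \<forall>n\<ge>1. \<forall>x y.
      \<bar>\<Psi> n x - \<Psi> n y\<bar> \<le> L * (\<Sum>j<n. dist ((T lam ^^ j) x) ((T lam ^^ j) y)))"
  unfolding AA_orb_def ennreal_finite_bound_iff
  using defect_le_iff L_orb_le_iff by auto

section \<open>Closure under differences, and the Birkhoff sums of \<open>D_fun m\<close>\<close>

lemma A_space_diff:
  assumes "\<Psi> \<in> A_space lam" "\<Phi> \<in> A_space lam"
  shows "\<Psi> - \<Phi> \<in> A_space lam"
proof -
  have "\<exists>g. continuous_on UNIV g \<and>
      (\<forall>\<^sub>F n in sequentially. \<forall>x. \<bar>(\<Psi> - \<Phi>) n x - birkhoff lam g n x\<bar> \<le> \<xi> * real n)"
    if "0 < \<xi>" for \<xi>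
  proof -
    from that have "0 < \<xi> / 2" by simp
    then obtain g h where gh: "continuous_on UNIV g" "continuous_on UNIV h"
      and ev: "\<forall>\<^sub>F n in sequentially. \<forall>x. \<bar>\<Psi> n x - birkhoff lam g n x\<bar> \<le> \<xi> / 2 * real n"
        "\<forall>\<^sub>F n in sequentially. \<forall>x. \<bar>\<Phi> n x - birkhoff lam h n x\<bar> \<le> \<xi> / 2 * real n"
      using assms unfolding A_space_iff by meson
    \<comment> \<open>Birkhoff sums are linear in the function, so \<open>g - h\<close> approximates
      the difference, with error \<open>\<xi> / 2\<close> from each part.\<close>
    have "\<forall>\<^sub>F n in sequentially. \<forall>x.
        \<bar>(\<Psi> - \<Phi>) n x - birkhoff lam (\<lambda>x. g x - h x) n x\<bar> \<le> \<xi> * real n"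
      using ev
    proof eventually_elim
      case (elim n)
      show ?case
      proof
        fix x
        show "\<bar>(\<Psi> - \<Phi>) n x - birkhoff lam (\<lambda>x. g x - h x) n x\<bar> \<le> \<xi> * real n"
          using elim(1)[rule_format, of x] elim(2)[rule_format, of x]
          unfolding birkhoff_def sum_subtractf minus_apply by linarith
      qed
    qed
    then show ?thesis using gh by (intro exI conjI) (auto intro: continuous_intros)
  qed
  then show ?thesis
    using assms unfolding A_space_iff
    by (auto simp: minus_apply fun_diff_def intro!: continuous_intros)
qed

lemma AA_orbI:
  assumes "\<Psi> \<in> A_space lam" "0 \<le> C" "0 \<le> L"
    and "\<And>n k x. 1 \<le> n \<Longrightarrow> 1 \<le> k \<Longrightarrow> \<bar>\<Psi> (n + k) x - \<Psi> n x - \<Psi> k ((T lam ^^ n) x)\<bar> \<le> C"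
    and "\<And>n x y. 1 \<le> n \<Longrightarrow> \<bar>\<Psi> n x - \<Psi> n y\<bar>
      \<le> L * (\<Sum>j<n. dist ((T lam ^^ j) x) ((T lam ^^ j) y))"
  shows "\<Psi> \<in> AA_orb lam"
  unfolding AA_orb_iff
  by (intro conjI exI[of _ C] exI[of _ L]) (use assms in simp_all)

lemma AA_orb_defectE:
  assumes "\<Psi> \<in> AA_orb lam"
  obtains C where "0 \<le> C"
    "\<And>n k x. 1 \<le> n \<Longrightarrow> 1 \<le> k \<Longrightarrow> \<bar>\<Psi> (n + k) x - \<Psi> n x - \<Psi> k ((T lam ^^ n) x)\<bar> \<le> C"
  using assms unfolding AA_orb_iff by blast

lemma AA_orb_lipschitzE:
  assumes "\<Psi> \<in> AA_orb lam"
  obtains L where "0 \<le> L"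
    "\<And>n x y. 1 \<le> n \<Longrightarrow> \<bar>\<Psi> n x - \<Psi> n y\<bar>
      \<le> L * (\<Sum>j<n. dist ((T lam ^^ j) x) ((T lam ^^ j) y))"
  using assms unfolding AA_orb_iff by blast

lemma AA_orb_diff:
  assumes "\<Psi> \<in> AA_orb lam" "\<Phi> \<in> AA_orb lam"
  shows "\<Psi> - \<Phi> \<in> AA_orb lam"
proof -
  obtain C where C: "0 \<le> C" "\<And>n k x. 1 \<le> n \<Longrightarrow> 1 \<le> k \<Longrightarrow>
      \<bar>\<Psi> (n + k) x - \<Psi> n x - \<Psi> k ((T lam ^^ n) x)\<bar> \<le> C"
    by (fact AA_orb_defectE[OF assms(1)])
  obtain C' where C': "0 \<le> C'" "\<And>n k x. 1 \<le> n \<Longrightarrow> 1 \<le> k \<Longrightarrow>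
      \<bar>\<Phi> (n + k) x - \<Phi> n x - \<Phi> k ((T lam ^^ n) x)\<bar> \<le> C'"
    by (fact AA_orb_defectE[OF assms(2)])
  obtain L where L: "0 \<le> L" "\<And>n x y. 1 \<le> n \<Longrightarrow>
      \<bar>\<Psi> n x - \<Psi> n y\<bar> \<le> L * (\<Sum>j<n. dist ((T lam ^^ j) x) ((T lam ^^ j) y))"
    by (fact AA_orb_lipschitzE[OF assms(1)])
  obtain L' where L': "0 \<le> L'" "\<And>n x y. 1 \<le> n \<Longrightarrow>
      \<bar>\<Phi> n x - \<Phi> n y\<bar> \<le> L' * (\<Sum>j<n. dist ((T lam ^^ j) x) ((T lam ^^ j) y))"
    by (fact AA_orb_lipschitzE[OF assms(2)])
  show ?thesis
  proof (rule AA_orbI)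
    show "\<Psi> - \<Phi> \<in> A_space lam"
      using assms by (intro A_space_diff) (simp_all add: AA_orb_iff)
    show "0 \<le> C + C'" "0 \<le> L + L'" using C(1) C'(1) L(1) L'(1) by simp_all
  next
    fix n k :: nat and x assume "1 \<le> n" "1 \<le> k"
    then show "\<bar>(\<Psi> - \<Phi>) (n + k) x - (\<Psi> - \<Phi>) n x - (\<Psi> - \<Phi>) k ((T lam ^^ n) x)\<bar> \<le> C + C'"
      using C(2)[of n k x] C'(2)[of n k x] unfolding minus_apply by linarith
  next
    fix n :: nat and x y assume "1 \<le> n"
    then show "\<bar>(\<Psi> - \<Phi>) n x - (\<Psi> - \<Phi>) n y\<bar>
        \<le> (L + L') * (\<Sum>j<n. dist ((T lam ^^ j) x) ((T lam ^^ j) y))"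
      using L(2)[of n x y] L'(2)[of n x y] unfolding minus_apply ring_distribs by linarith
  qed
qed

lemma null_space_diff:
  assumes "\<Psi> \<in> null_space lam" "\<Phi> \<in> null_space lam"
  shows "\<Psi> - \<Phi> \<in> null_space lam"
  unfolding null_space_iff
proof (intro conjI allI impI)
  fix \<xi> :: real assume "0 < \<xi>"
  then have "0 < \<xi> / 2" by simp
  then have "\<forall>\<^sub>F n in sequentially. \<forall>x. \<bar>\<Psi> n x\<bar> \<le> \<xi> / 2 * real n"
    "\<forall>\<^sub>F n in sequentially. \<forall>x. \<bar>\<Phi> n x\<bar> \<le> \<xi> / 2 * real n"
    using assms unfolding null_space_iff by blast+
  then show "\<forall>\<^sub>F n in sequentially. \<forall>x. \<bar>(\<Psi> - \<Phi>) n x\<bar> \<le> \<xi> * real n"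
  proof eventually_elim
    case (elim n)
    show ?case
    proof
      fix x show "\<bar>(\<Psi> - \<Phi>) n x\<bar> \<le> \<xi> * real n"
        using elim(1)[rule_format, of x] elim(2)[rule_format, of x] unfolding minus_apply by linarith
    qed
  qed
qed (use assms A_space_diff null_space_iff in blast)

text \<open>\<open>D_fun m\<close> is its own exact approximant, additivity gives defect 0, and the
  1-Lipschitz bound for \<open>D_fun m\<close>, summed along the orbit, gives constant 1.\<close>

lemma birkhoff_D_fun_in_AA_orb:
  assumes "0 < lam" "lam < 1"
  shows "birkhoff lam (D_fun m) \<in> AA_orb lam"
proof (rule AA_orbI[where C = 0 and L = 1])
  have "\<forall>\<xi>>0. \<exists>g. continuous_on UNIV g \<and> (\<forall>\<^sub>F n in sequentially.
      \<forall>x. \<bar>birkhoff lam (D_fun m) n x - birkhoff lam g n x\<bar> \<le> \<xi> * real n)"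
    by (intro allI impI exI[of _ "D_fun m"]) (simp add: continuous_D_fun)
  then show "birkhoff lam (D_fun m) \<in> A_space lam"
    unfolding A_space_iff
    using continuous_birkhoff[OF assms continuous_D_fun] by (simp add: birkhoff_def[of _ _ 0])
next
  fix n k :: nat and x
  show "\<bar>birkhoff lam (D_fun m) (n + k) x - birkhoff lam (D_fun m) n x
      - birkhoff lam (D_fun m) k ((T lam ^^ n) x)\<bar> \<le> 0"
    by (simp add: birkhoff_add_index[OF assms])
next
  fix n :: nat and x y
  have "\<bar>birkhoff lam (D_fun m) n x - birkhoff lam (D_fun m) n y\<bar>
      \<le> (\<Sum>j<n. \<bar>D_fun m ((T lam ^^ j) x) - D_fun m ((T lam ^^ j) y)\<bar>)"
    unfolding birkhoff_def sum_subtractf[symmetric] by (rule sum_abs)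
  also have "\<dots> \<le> (\<Sum>j<n. dist ((T lam ^^ j) x) ((T lam ^^ j) y))"
    by (intro sum_mono D_fun_lipschitz)
  finally show "\<bar>birkhoff lam (D_fun m) n x - birkhoff lam (D_fun m) n y\<bar>
      \<le> 1 * (\<Sum>j<n. dist ((T lam ^^ j) x) ((T lam ^^ j) y))" by simp
qed simp_all

section \<open>The alternating height term and the class of \<open>Phi\<close>\<close>

text \<open>The non-additive summand of \<open>Phi\<close>. It is bounded uniformly in
  \<open>n\<close>, so it disappears in the quotient. The value 0 at index 0 is the normalisation
  demanded by \<open>A_space\<close>.\<close>

definition alt_height :: "nat \<Rightarrow> xpt \<Rightarrow> real" where
  "alt_height n = (if n = 0 then (\<lambda>_. 0) else (\<lambda>x. (- 1) ^ n * height x))"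

lemma abs_alt_height_le_1: "\<bar>alt_height n x\<bar> \<le> 1"
  using height_nonneg[of x] height_le_1[of x]
  by (simp add: alt_height_def abs_mult power_abs)

lemma eventually_alt_height_le:
  assumes "0 < \<xi>"
  shows "\<forall>\<^sub>F n in sequentially. \<forall>x. \<bar>alt_height n x\<bar> \<le> \<xi> * real n"
proof -
  have "\<forall>\<^sub>F n in sequentially. 1 / \<xi> \<le> real n"
    using filterlim_real_sequentially unfolding filterlim_at_top by blast
  then show ?thesis
  proof eventually_elim
    case (elim n)
    then have "1 \<le> \<xi> * real n" using assms by (simp add: field_simps)
    then show ?case using abs_alt_height_le_1 order_trans by blast
  qed
qed

text \<open>A uniformly bounded sequence is approximated by the Birkhoff sums of the zero
  function.\<close>

lemma alt_height_in_A_space: "alt_height \<in> A_space lam"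
proof -
  have "\<forall>\<xi>>0. \<exists>g. continuous_on UNIV g \<and> (\<forall>\<^sub>F n in sequentially.
      \<forall>x. \<bar>alt_height n x - birkhoff lam g n x\<bar> \<le> \<xi> * real n)"
    by (intro allI impI exI[of _ "\<lambda>_. 0"])
      (simp add: eventually_alt_height_le birkhoff_def)
  then show ?thesis
    unfolding A_space_iff
    by (auto simp: alt_height_def intro!: continuous_intros continuous_height)
qed

text \<open>The defect consists of three terms of size at most 1. In a difference at equal
  \<open>n\<close> the sign drops out, leaving the height difference, which the first orbit distance
  dominates.\<close>

lemma alt_height_in_AA_orb: "alt_height \<in> AA_orb lam"
proof (rule AA_orbI[OF alt_height_in_A_space, where C = 3 and L = 1])
  fix n k :: nat and x
  show "\<bar>alt_height (n + k) x - alt_height n x - alt_height k ((T lam ^^ n) x)\<bar> \<le> 3"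
    using abs_alt_height_le_1[of "n + k" x] abs_alt_height_le_1[of n x]
      abs_alt_height_le_1[of k "(T lam ^^ n) x"] by linarith
next
  fix n :: nat and x y assume n: "1 \<le> n"
  then have "\<bar>alt_height n x - alt_height n y\<bar> = \<bar>height x - height y\<bar>"
    by (simp add: alt_height_def abs_mult power_abs flip: right_diff_distrib)
  also have "\<dots> \<le> dist x y" by (rule height_diff_le_dist)
  also have "\<dots> \<le> (\<Sum>j<n. dist ((T lam ^^ j) x) ((T lam ^^ j) y))"
    by (rule dist_le_orbit_sum[OF n])
  finally show "\<bar>alt_height n x - alt_height n y\<bar>
      \<le> 1 * (\<Sum>j<n. dist ((T lam ^^ j) x) ((T lam ^^ j) y))" by simp
qed simp_all

lemma alt_height_in_null_space: "alt_height \<in> null_space lam"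
  by (simp add: null_space_iff alt_height_in_A_space eventually_alt_height_le)

lemma Phi_eq: "Phi lam m = alt_height - birkhoff lam (D_fun m)"
  by (intro ext) (simp add: Phi_def alt_height_def birkhoff_def)

lemma Phi_in_AA_orb: "0 < lam \<Longrightarrow> lam < 1 \<Longrightarrow> Phi lam m \<in> AA_orb lam"
  unfolding Phi_eq by (intro AA_orb_diff alt_height_in_AA_orb birkhoff_D_fun_in_AA_orb)

lemma Phi_not_additive:
  assumes "0 < lam" "lam < 1"
  shows "\<exists>x. Phi lam m (1 + 1) x \<noteq> Phi lam m 1 x + Phi lam m 1 ((T lam ^^ 1) x)"
proof
  \<comment> \<open>At height 1 the Birkhoff parts cancel by additivity and the alternating parts
    would require \<open>1 = - 1 - lam\<close>.\<close>
  define x where "x = Abs_xpt (Abs_ypt (0, 0), 1)"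
  have "height x = 1" by (simp add: x_def height_def Abs_xpt_inverse)
  then show "Phi lam m (1 + 1) x \<noteq> Phi lam m 1 x + Phi lam m 1 ((T lam ^^ 1) x)"
    using assms
    by (simp only: Phi_eq minus_apply birkhoff_add_index) (simp add: alt_height_def height_T)
qed

lemma AA_orb_uminus:
  assumes "\<Psi> \<in> AA_orb lam"
  shows "- \<Psi> \<in> AA_orb lam"
proof -
  \<comment> \<open>Negation is obtained from closure under differences.\<close>
  have "(\<Psi> - \<Psi>) - \<Psi> \<in> AA_orb lam" using assms by (intro AA_orb_diff)
  moreover have "(\<Psi> - \<Psi>) - \<Psi> = - \<Psi>" by (simp add: fun_eq_iff)
  ultimately show ?thesis by simp
qed

lemma E_class_Phi:
  assumes "0 < lam" "lam < 1"
  shows "E_class lam (Phi lam m) = E_uminus (E_class lam (birkhoff lam (D_fun m)))"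
proof -
  let ?S = "birkhoff lam (D_fun m)"
  have in_class: "\<Psi> \<in> E_class lam (Phi lam m) \<longleftrightarrow> - \<Psi> \<in> E_class lam ?S" for \<Psi>
  proof -
    have AA: "- \<Psi> \<in> AA_orb lam \<longleftrightarrow> \<Psi> \<in> AA_orb lam"
      using AA_orb_uminus[of \<Psi> lam] AA_orb_uminus[of "- \<Psi>" lam] by (auto simp: fun_Compl_def)
    \<comment> \<open>The two differences add up to \<open>alt_height\<close>, which is null and in
      \<open>AA_orb\<close>; hence each has these properties exactly when the other does.\<close>
    have eq: "?S - - \<Psi> = alt_height - (Phi lam m - \<Psi>)" "Phi lam m - \<Psi> = alt_height - (?S - - \<Psi>)"
      by (simp_all add: Phi_eq fun_eq_iff)
    have "?S - - \<Psi> \<in> null_space lam \<longleftrightarrow> Phi lam m - \<Psi> \<in> null_space lam"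
      using null_space_diff[OF alt_height_in_null_space] eq by metis
    moreover have "?S - - \<Psi> \<in> AA_orb lam \<longleftrightarrow> Phi lam m - \<Psi> \<in> AA_orb lam"
      using AA_orb_diff[OF alt_height_in_AA_orb] eq by metis
    ultimately show ?thesis
      using AA Phi_in_AA_orb[OF assms] birkhoff_D_fun_in_AA_orb[OF assms]
      by (simp add: E_class_def E_rel_def)
  qed
  show ?thesis
  proof (intro equalityI subsetI)
    fix \<Psi> assume "\<Psi> \<in> E_class lam (Phi lam m)"
    then have "- \<Psi> \<in> E_class lam ?S" using in_class by blast
    moreover have "\<Psi> = - (- \<Psi>)" by (simp add: fun_eq_iff)
    ultimately show "\<Psi> \<in> E_uminus (E_class lam ?S)" unfolding E_uminus_def by blast
  qed (auto simp: E_uminus_def in_class fun_Compl_def)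
qed

section \<open>Evaluation of classes at invariant measures\<close>

text \<open>The averages at \<open>n\<close> and at \<open>k\<close> are both compared with the
  average at the common multiple \<open>k * n\<close>; the errors \<open>C / n\<close> and
  \<open>C / k\<close> make the averages a Cauchy sequence.\<close>

lemma almost_additive_convergent:
  fixes a :: "nat \<Rightarrow> real"
  assumes a: "\<And>n k. 1 \<le> n \<Longrightarrow> 1 \<le> k \<Longrightarrow> \<bar>a (n + k) - a n - a k\<bar> \<le> C"
  shows "convergent (\<lambda>n. a n / real n)"
proof -
  have C: "0 \<le> C" using a[of 1 1] by simp
  \<comment> \<open>Splitting off one block of length \<open>n\<close> at a time costs at most
    \<open>C\<close> per block.\<close>
  have mult: "\<bar>a (Suc k * n) - real (Suc k) * a n\<bar> \<le> real (Suc k) * C" if "1 \<le> n" for k n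
  proof (induction k)
    case 0
    then show ?case using C by simp
  next
    case (Suc k)
    have "\<bar>a (Suc k * n + n) - a (Suc k * n) - a n\<bar> \<le> C"
      using that by (intro a) auto
    with Suc show ?case
      by (simp add: algebra_simps)
  qed
  have close: "\<bar>a (k * n) / real (k * n) - a n / real n\<bar> \<le> C / real n" if nk: "1 \<le> n" "1 \<le> k" for k n
  proof -
    obtain k' where k': "k = Suc k'" using nk(2) by (cases k) auto
    have "a (k * n) / real (k * n) - a n / real n = (a (k * n) - real k * a n) / real (k * n)"
      using nk by (simp add: field_simps)
    also have "\<bar>\<dots>\<bar> = \<bar>a (k * n) - real k * a n\<bar> / real (k * n)"
      by (simp add: abs_divide)
    also have "\<dots> \<le> real k * C / real (k * n)"
      using mult[OF nk(1), of k'] unfolding k' by (intro divide_right_mono) auto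
    also have "\<dots> = C / real n" using nk by simp
    finally show ?thesis .
  qed
  have "Cauchy (\<lambda>n. a n / real n)"
  proof (rule metric_CauchyI)
    fix e :: real assume e: "0 < e"
    obtain N where N: "2 * C / e < real N" using reals_Archimedean2 by blast
    have "dist (a n / real n) (a k / real k) < e" if nk: "n \<ge> Suc N" "k \<ge> Suc N" for n k
    proof -
      have small: "C / real j < e / 2" if "j \<ge> Suc N" for j
      proof -
        have "2 * C / e < real j" using N that by simp
        then show ?thesis using e that by (simp add: field_simps)
      qed
      have "\<bar>a (k * n) / real (k * n) - a n / real n\<bar> \<le> C / real n"
        "\<bar>a (k * n) / real (k * n) - a k / real k\<bar> \<le> C / real k"
        using close[of n k] close[of k n] nk by (simp_all add: mult.commute)
      then show ?thesis using small[OF nk(1)] small[OF nk(2)] unfolding dist_real_def by linarith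
    qed
    then show "\<exists>M. \<forall>n\<ge>M. \<forall>k\<ge>M. dist (a n / real n) (a k / real k) < e" by blast
  qed
  then show ?thesis by (rule Cauchy_convergent)
qed

section \<open>Integration against invariant measures\<close>

lemma inv_measuresD:
  assumes "\<nu> \<in> inv_measures lam"
  shows "prob_space \<nu>" "sets \<nu> = sets borel" "space \<nu> = UNIV" "distr \<nu> borel (T lam) = \<nu>"
  using assms sets_eq_imp_space_eq[of \<nu> borel] by (auto simp: inv_measures_def)

lemma abs_integral_le:
  fixes f :: "'a \<Rightarrow> real"
  assumes "prob_space \<nu>" "integrable \<nu> f" "\<And>x. \<bar>f x\<bar> \<le> c"
  shows "\<bar>LINT x|\<nu>. f x\<bar> \<le> c"
proof -
  interpret prob_space \<nu> by fact
  have "f x \<le> c" "- c \<le> f x" for x using assms(3)[of x] by linarith+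
  then have "(LINT x|\<nu>. f x) \<le> c" "- c \<le> (LINT x|\<nu>. f x)"
    using assms(2) by (auto intro!: integral_le_const integral_ge_const)
  then show ?thesis by linarith
qed

lemma integrable_continuous_bounded:
  fixes f :: "xpt \<Rightarrow> real"
  assumes "\<nu> \<in> inv_measures lam" "continuous_on UNIV f" "\<And>x. \<bar>f x\<bar> \<le> c"
  shows "integrable \<nu> f"
proof -
  interpret prob_space \<nu> using inv_measuresD(1)[OF assms(1)] .
  have "f \<in> borel_measurable \<nu>"
    using borel_measurable_continuous_onI[OF assms(2)]
      measurable_cong_sets[OF inv_measuresD(2)[OF assms(1)] refl] by blast
  then show ?thesis
    using assms(3) by (intro integrable_const_bound[of _ c]) auto
qed

lemma AA_orb_continuous: "\<Psi> \<in> AA_orb lam \<Longrightarrow> continuous_on UNIV (\<Psi> n)"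
  by (cases "n = 0") (auto simp: AA_orb_iff A_space_iff)

lemma AA_orb_bounded:
  assumes "\<Psi> \<in> AA_orb lam"
  obtains c where "\<And>x. \<bar>\<Psi> n x\<bar> \<le> c"
proof (cases "n = 0")
  case True
  then show ?thesis using that[of 0] assms by (simp add: AA_orb_iff A_space_iff)
next
  case False
  obtain L where L: "0 \<le> L" "\<And>n x y. 1 \<le> n \<Longrightarrow>
      \<bar>\<Psi> n x - \<Psi> n y\<bar> \<le> L * (\<Sum>j<n. dist ((T lam ^^ j) x) ((T lam ^^ j) y))"
    by (fact AA_orb_lipschitzE[OF assms])
  \<comment> \<open>An arbitrary reference point: by the orbit Lipschitz bound and the diameter
    bound, \<open>\<Psi> n\<close> stays within \<open>2 * L * n\<close> of its value at
    \<open>z\<close>.\<close>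
  fix z
  have "\<bar>\<Psi> n x\<bar> \<le> \<bar>\<Psi> n z\<bar> + L * (\<Sum>j<n. 2)" for x
  proof -
    have "\<bar>\<Psi> n x - \<Psi> n z\<bar> \<le> L * (\<Sum>j<n. dist ((T lam ^^ j) x) ((T lam ^^ j) z))"
      using False by (intro L) auto
    also have "\<dots> \<le> L * (\<Sum>j<n. 2)"
      using L(1) by (intro mult_left_mono sum_mono dist_xpt_le_2)
    finally show ?thesis by linarith
  qed
  then show ?thesis by (rule that)
qed

lemma AA_orb_integrable:
  assumes "\<Psi> \<in> AA_orb lam" "\<nu> \<in> inv_measures lam"
  shows "integrable \<nu> (\<Psi> n)"
proof -
  obtain c where "\<And>x. \<bar>\<Psi> n x\<bar> \<le> c" by (fact AA_orb_bounded[OF assms(1), where n = n])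
  then show ?thesis
    using integrable_continuous_bounded assms AA_orb_continuous by metis
qed

lemma integral_T_pow:
  assumes "0 < lam" "lam < 1" "\<nu> \<in> inv_measures lam" "f \<in> borel_measurable borel"
  shows "(LINT x|\<nu>. f ((T lam ^^ k) x) :: real) = (LINT x|\<nu>. f x)"
proof (induction k)
  case (Suc k)
  note [measurable] = assms(4) borel_measurable_continuous_onI[OF continuous_T_pow[OF assms(1,2)]]
  have T: "T lam \<in> measurable \<nu> borel"
    using T_measurable[OF assms(1,2)] measurable_cong_sets[OF inv_measuresD(2)[OF assms(3)] refl]
    by blast
  \<comment> \<open>The innermost \<open>T lam\<close> is split off, so that the change of variables
    turns it into the image measure, which equals \<open>\<nu>\<close>.\<close>
  have "(LINT x|\<nu>. f ((T lam ^^ Suc k) x)) = (LINT x|\<nu>. f ((T lam ^^ k) (T lam x)))"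
    by (simp add: funpow_Suc_right del: funpow.simps)
  also have "\<dots> = (LINT x|distr \<nu> borel (T lam). f ((T lam ^^ k) x))"
    by (subst integral_distr[OF T]) simp_all
  also have "\<dots> = (LINT x|\<nu>. f x)"
    using Suc inv_measuresD(4)[OF assms(3)] by simp
  finally show ?case .
qed simp

text \<open>Invariance removes the shift by \<open>T lam ^^ n\<close> under the integral, so the
  integrals form an almost additive sequence of reals.\<close>

lemma AA_orb_integral_convergent:
  assumes "0 < lam" "lam < 1" "\<Psi> \<in> AA_orb lam" "\<nu> \<in> inv_measures lam"
  shows "convergent (\<lambda>n. (LINT x|\<nu>. \<Psi> n x) / real n)"
proof -
  obtain C where C: "0 \<le> C" "\<And>n k x. 1 \<le> n \<Longrightarrow> 1 \<le> k \<Longrightarrow>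
      \<bar>\<Psi> (n + k) x - \<Psi> n x - \<Psi> k ((T lam ^^ n) x)\<bar> \<le> C"
    by (fact AA_orb_defectE[OF assms(3)])
  have "\<bar>(LINT x|\<nu>. \<Psi> (n + k) x) - (LINT x|\<nu>. \<Psi> n x) - (LINT x|\<nu>. \<Psi> k x)\<bar> \<le> C"
    if "1 \<le> n" "1 \<le> k" for n k
  proof -
    have int: "integrable \<nu> (\<Psi> j)" for j by (rule AA_orb_integrable[OF assms(3,4)])
    obtain c where c: "\<And>x. \<bar>\<Psi> k x\<bar> \<le> c" by (fact AA_orb_bounded[OF assms(3), where n = k])
    have intT: "integrable \<nu> (\<lambda>x. \<Psi> k ((T lam ^^ n) x))"
      using c continuous_on_compose2[OF AA_orb_continuous[OF assms(3)] continuous_T_pow[OF assms(1,2)]]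
      by (intro integrable_continuous_bounded[OF assms(4)]) auto
    have "(LINT x|\<nu>. \<Psi> (n + k) x - \<Psi> n x - \<Psi> k ((T lam ^^ n) x))
        = (LINT x|\<nu>. \<Psi> (n + k) x) - (LINT x|\<nu>. \<Psi> n x) - (LINT x|\<nu>. \<Psi> k x)"
      using int intT integral_T_pow[OF assms(1,2,4)
          borel_measurable_continuous_onI[OF AA_orb_continuous[OF assms(3)]], of k n]
      by simp
    moreover have "\<bar>LINT x|\<nu>. \<Psi> (n + k) x - \<Psi> n x - \<Psi> k ((T lam ^^ n) x)\<bar> \<le> C"
      using int intT C(2) that inv_measuresD(1)[OF assms(4)] by (intro abs_integral_le) auto
    ultimately show ?thesis by simp
  qed
  then show ?thesis by (rule almost_additive_convergent)
qed

lemma null_space_integral_tendsto: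
  assumes "\<nu> \<in> inv_measures lam" "\<Psi> \<in> null_space lam" "\<And>n. integrable \<nu> (\<Psi> n)"
  shows "(\<lambda>n. (LINT x|\<nu>. \<Psi> n x) / real n) \<longlonglongrightarrow> 0"
proof (rule tendstoI)
  fix e :: real assume e: "0 < e"
  then have "\<forall>\<^sub>F n in sequentially. \<forall>x. \<bar>\<Psi> n x\<bar> \<le> e / 2 * real n"
    using assms(2) unfolding null_space_iff by (meson half_gt_zero)
  then show "\<forall>\<^sub>F n in sequentially. dist ((LINT x|\<nu>. \<Psi> n x) / real n) 0 < e"
    using eventually_gt_at_top[of 0]
  proof eventually_elim
    case (elim n)
    then have "\<bar>LINT x|\<nu>. \<Psi> n x\<bar> \<le> e / 2 * real n"
      using abs_integral_le[OF inv_measuresD(1)[OF assms(1)] assms(3)] by blast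
    also have "\<dots> < e * real n" using e elim(2) by simp
    finally show ?case using elim(2) by (simp add: abs_divide pos_divide_less_eq)
  qed
qed

section \<open>Independence of the representative\<close>

lemma E_orbD:
  assumes "\<eta> \<in> E_orb lam" "\<Psi> \<in> \<eta>" "\<Phi> \<in> \<eta>"
  shows "\<Psi> \<in> AA_orb lam" "\<Psi> - \<Phi> \<in> null_space lam"
proof -
  obtain \<Psi>0 where \<eta>: "\<eta> = E_rel lam `` {\<Psi>0}"
    using assms(1) by (auto simp: E_orb_def quotient_def)
  then show "\<Psi> \<in> AA_orb lam" using assms(2) by (simp add: E_rel_def)
  have "\<Psi>0 - \<Phi> \<in> null_space lam" "\<Psi>0 - \<Psi> \<in> null_space lam"
    using \<eta> assms(2,3) by (simp_all add: E_rel_def)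
  then have "(\<Psi>0 - \<Phi>) - (\<Psi>0 - \<Psi>) \<in> null_space lam" by (rule null_space_diff)
  moreover have "(\<Psi>0 - \<Phi>) - (\<Psi>0 - \<Psi>) = \<Psi> - \<Phi>" by (simp add: fun_eq_iff)
  ultimately show "\<Psi> - \<Phi> \<in> null_space lam" by simp
qed

text \<open>This justifies the \<open>THE\<close> in \<open>E_eval\<close>: one representative has a
  limit by almost additivity, and the others share it because they differ by a null
  sequence.\<close>

lemma E_eval_tendsto:
  assumes lam: "0 < lam" "lam < 1" and "\<eta> \<in> E_orb lam" "\<Psi> \<in> \<eta>" "\<nu> \<in> inv_measures lam"
  shows "(\<lambda>n. (LINT x|\<nu>. \<Psi> n x) / real n) \<longlonglongrightarrow> E_eval \<eta> \<nu>"
proof -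
  have AA: "\<Phi> \<in> AA_orb lam" if "\<Phi> \<in> \<eta>" for \<Phi> using E_orbD(1)[OF assms(3) that that] .
  obtain c where c: "(\<lambda>n. (LINT x|\<nu>. \<Psi> n x) / real n) \<longlonglongrightarrow> c"
    using AA_orb_integral_convergent[OF lam AA[OF assms(4)] assms(5)] by (auto simp: convergent_def)
  have all: "(\<lambda>n. (LINT x|\<nu>. \<Phi> n x) / real n) \<longlonglongrightarrow> c" if "\<Phi> \<in> \<eta>" for \<Phi>
  proof -
    have int: "integrable \<nu> (\<Psi> n)" "integrable \<nu> (\<Phi> n)" for n
      using AA_orb_integrable AA assms(4,5) that by blast+
    have "(\<lambda>n. (LINT x|\<nu>. (\<Phi> - \<Psi>) n x) / real n) \<longlonglongrightarrow> 0"
      using E_orbD(2)[OF assms(3) that assms(4)] int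
      by (intro null_space_integral_tendsto[OF assms(5)]) (auto simp: fun_diff_def)
    from tendsto_add[OF this c] show ?thesis
      using int by (simp add: diff_divide_distrib)
  qed
  have "E_eval \<eta> \<nu> = c"
    unfolding E_eval_def
  proof (rule the_equality)
    fix c' assume "\<forall>\<Phi>\<in>\<eta>. (\<lambda>n. (LINT x|\<nu>. \<Phi> n x) / real n) \<longlonglongrightarrow> c'"
    then show "c' = c" using c assms(4) LIMSEQ_unique by blast
  qed (use all in blast)
  with c show ?thesis by simp
qed

section \<open>The measures \<open>\<mu>\<^sub>m\<close>\<close>

lemma sets_mu [simp]: "sets (mu m) = sets borel" and space_mu [simp]: "space (mu m) = UNIV"
  by (simp_all add: mu_def)

lemma Z_in_borel: "Z m \<in> sets borel"
  by (intro borel_closed finite_imp_closed finite_Z)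

lemma emeasure_mu:
  assumes "A \<in> sets borel"
  shows "emeasure (mu m) A = ennreal (card (A \<inter> Z m) / card (Z m))"
proof -
  \<comment> \<open>All subsets of \<open>Z m\<close> are measurable for the uniform count measure,
    so the inclusion map is measurable.\<close>
  have "(\<lambda>x. x) \<in> measurable (uniform_count_measure (Z m)) borel"
    by (simp add: measurable_def space_uniform_count_measure sets_uniform_count_measure)
  then have "emeasure (mu m) A = emeasure (uniform_count_measure (Z m)) (A \<inter> Z m)"
    using assms by (simp add: mu_def emeasure_distr space_uniform_count_measure vimage_def Int_def)
  then show ?thesis
    by (simp add: emeasure_uniform_count_measure finite_Z)
qed

lemma card_Z_pos: "0 < card (Z m)"
  using finite_Z Z_nonempty by (simp add: card_gt_0_iff)

lemma prob_space_mu: "prob_space (mu m)"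
  using card_Z_pos[of m] by (intro prob_spaceI) (simp add: emeasure_mu)

lemma AE_mu_in_Z: "AE x in mu m. x \<in> Z m"
  using Z_in_borel[of m] by (subst AE_iff_measurable[of "- Z m"]) (auto simp: emeasure_mu)

text \<open>\<open>T lam\<close> permutes the finite set \<open>Z m\<close>, so a set and its
  preimage contain equally many points of \<open>Z m\<close>.\<close>

lemma mu_in_inv_measures:
  assumes lam: "0 < lam" "lam < 1"
  shows "mu m \<in> inv_measures lam"
proof -
  have meas: "T lam \<in> measurable (mu m) borel"
    using T_measurable[OF lam] measurable_cong_sets[OF sets_mu refl] by blast
  have inj: "inj_on (T lam) (Z m)"
  proof (rule eq_card_imp_inj_on[OF finite_Z])
    \<comment> \<open>Each point returns to itself after \<open>k \<ge> 1\<close> steps, so the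
      point reached after \<open>k - 1\<close> steps is a preimage. Surjectivity on a finite set
      then gives injectivity.\<close>
    have "Z m \<subseteq> T lam ` Z m"
    proof
      fix y assume y: "y \<in> Z m"
      then obtain k where k: "1 \<le> k" "(T lam ^^ k) y = y" by (rule T_transitive_Z[OF lam y])
      then have "y = T lam ((T lam ^^ (k - 1)) y)" by (cases k) auto
      then show "y \<in> T lam ` Z m" using T_pow_in_Z[OF lam y] by blast
    qed
    then have "T lam ` Z m = Z m" using T_in_Z[OF lam] by blast
    then show "card (T lam ` Z m) = card (Z m)" by simp
  qed
  then have image: "T lam ` Z m = Z m"
    using T_in_Z[OF lam] by (intro endo_inj_surj[OF finite_Z]) auto
  have "distr (mu m) borel (T lam) = mu m"
  proof (rule measure_eqI)
    fix A assume "A \<in> sets (distr (mu m) borel (T lam))"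
    then have A: "A \<in> sets borel" by simp
    have "T lam -` A \<in> sets borel"
      using measurable_sets[OF T_measurable[OF lam] A] by simp
    moreover have "card (T lam -` A \<inter> Z m) = card (A \<inter> Z m)"
    proof -
      have "T lam ` (T lam -` A \<inter> Z m) = A \<inter> T lam ` Z m" by blast
      then show ?thesis
        using card_image[OF inj_on_subset[OF inj Int_lower2], of "T lam -` A"] image by simp
    qed
    ultimately show "emeasure (distr (mu m) borel (T lam)) A = emeasure (mu m) A"
      using A by (simp add: emeasure_distr[OF meas] emeasure_mu)
  qed simp
  then show ?thesis by (simp add: inv_measures_def prob_space_mu)
qed

text \<open>Since \<open>{z} \<subseteq> T\<^sup>-\<^sup>1{Tz}\<close>, an invariant measure gives the points of a periodic orbit nondecreasing,
  hence equal, masses.\<close>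

lemma inv_measure_eq_mu:
  assumes lam: "0 < lam" "lam < 1" and \<nu>: "\<nu> \<in> inv_measures lam" and AE: "AE x in \<nu>. x \<in> Z m"
  shows "\<nu> = mu m"
proof -
  interpret prob_space \<nu> using inv_measuresD(1)[OF \<nu>] .
  note sets[simp] = inv_measuresD(2)[OF \<nu>] and space[simp] = inv_measuresD(3)[OF \<nu>]
  have meas: "T lam \<in> measurable \<nu> borel"
    using T_measurable[OF lam] measurable_cong_sets[OF sets refl] by blast
  have step: "prob {z} \<le> prob {T lam z}" for z
  proof -
    have pre: "T lam -` {T lam z} \<in> sets \<nu>"
      using measurable_sets[OF meas, of "{T lam z}"] by simp
    have "prob {z} \<le> prob (T lam -` {T lam z})"
      using pre by (intro finite_measure_mono) auto
    also have "\<dots> = measure (distr \<nu> borel (T lam)) {T lam z}"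
      by (subst measure_distr[OF meas]) simp_all
    finally show ?thesis by (simp add: inv_measuresD(4)[OF \<nu>])
  qed
  have steps: "prob {z} \<le> prob {(T lam ^^ k) z}" for z k
    by (induction k) (use step order_trans in auto)
  obtain z where z: "z \<in> Z m" using Z_nonempty by blast
  have mass: "prob {y} = prob {z}" if "y \<in> Z m" for y
    using T_transitive_Z[OF lam that z] T_transitive_Z[OF lam z that] steps by (metis order_antisym)
  have measure_eq: "prob A = card (A \<inter> Z m) * prob {z}" if "A \<in> sets borel" for A
  proof -
    have "prob A = prob (A \<inter> Z m)"
      using AE that Z_in_borel[of m] by (intro finite_measure_eq_AE) auto
    also have "\<dots> = (\<Sum>y\<in>A \<inter> Z m. prob {y})"
      using finite_Z by (intro finite_measure_eq_sum_singleton) auto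
    also have "\<dots> = card (A \<inter> Z m) * prob {z}" using mass by simp
    finally show ?thesis .
  qed
  have "1 = card (Z m) * prob {z}"
    using measure_eq[of UNIV] prob_space by simp
  then have "prob {z} = 1 / card (Z m)"
    using card_Z_pos[of m] by (simp add: field_simps)
  with measure_eq show ?thesis
    by (intro measure_eqI) (auto simp: emeasure_eq_measure emeasure_mu)
qed

section \<open>Integrals of \<open>D_fun m\<close> and its Birkhoff sums\<close>

lemma integrable_D_fun:
  assumes "0 < lam" "lam < 1" "\<nu> \<in> inv_measures lam"
  shows "integrable \<nu> (D_fun m)"
  using AA_orb_integrable[OF birkhoff_D_fun_in_AA_orb[OF assms(1,2)] assms(3), of m 1]
  by (simp add: birkhoff_def)

lemma integral_birkhoff_D_fun:
  assumes lam: "0 < lam" "lam < 1" and \<nu>: "\<nu> \<in> inv_measures lam"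
  shows "(LINT x|\<nu>. birkhoff lam (D_fun m) n x) = real n * (LINT x|\<nu>. D_fun m x)"
proof (induction n)
  case 0
  then show ?case by (simp add: birkhoff_def)
next
  case (Suc n)
  let ?S = "birkhoff lam (D_fun m)"
  have int: "integrable \<nu> (?S j)" for j
    by (intro AA_orb_integrable[OF birkhoff_D_fun_in_AA_orb[OF lam] \<nu>])
  have eq: "?S (Suc n) x = ?S n x + D_fun m ((T lam ^^ n) x)" for x
    by (simp add: birkhoff_def)
  \<comment> \<open>The new summand is integrable as the difference of consecutive Birkhoff
    sums.\<close>
  have "integrable \<nu> (\<lambda>x. ?S (Suc n) x - ?S n x)" using int by simp
  then have "integrable \<nu> (\<lambda>x. D_fun m ((T lam ^^ n) x))" by (simp add: eq)
  then have "(LINT x|\<nu>. ?S (Suc n) x) = (LINT x|\<nu>. ?S n x) + (LINT x|\<nu>. D_fun m ((T lam ^^ n) x))"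
    using int by (simp add: eq)
  then show ?case
    using Suc integral_T_pow[OF lam \<nu> borel_measurable_continuous_onI[OF continuous_D_fun]]
    by (simp add: algebra_simps)
qed

section \<open>Stability of the maximizing measure\<close>

lemma E_class_in_E_orb: "\<Psi> \<in> AA_orb lam \<Longrightarrow> E_class lam \<Psi> \<in> E_orb lam"
  by (simp add: E_class_def E_orb_def quotientI)

lemma in_E_class:
  assumes "\<Psi> \<in> AA_orb lam"
  shows "\<Psi> \<in> E_class lam \<Psi>"
proof -
  \<comment> \<open>The zero sequence is recognised as null by writing it as a difference of known
    null sequences.\<close>
  have "\<Psi> - \<Psi> = alt_height - alt_height" by (simp add: fun_eq_iff)
  then show ?thesis
    using assms AA_orb_diff[OF assms assms]
      null_space_diff[OF alt_height_in_null_space alt_height_in_null_space, of lam]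
    by (simp add: E_class_def E_rel_def)
qed

text \<open>On the representative \<open>Phi\<close> the Birkhoff part contributes exactly minus the
  integral of \<open>D_fun m\<close> for every \<open>n \<ge> 1\<close>, while the average of the
  alternating part tends to 0.\<close>

lemma E_eval_E_class_Phi:
  assumes lam: "0 < lam" "lam < 1" and \<nu>: "\<nu> \<in> inv_measures lam"
  shows "E_eval (E_class lam (Phi lam m)) \<nu> = - (LINT x|\<nu>. D_fun m x)"
proof -
  have int: "integrable \<nu> (alt_height n)" "integrable \<nu> (birkhoff lam (D_fun m) n)" for n
    using AA_orb_integrable \<nu> alt_height_in_AA_orb birkhoff_D_fun_in_AA_orb[OF lam] by blast+
  have "(\<lambda>n. (LINT x|\<nu>. alt_height n x) / real n - (LINT x|\<nu>. D_fun m x)) \<longlonglongrightarrow>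
      0 - (LINT x|\<nu>. D_fun m x)"
    by (intro tendsto_diff tendsto_const
        null_space_integral_tendsto[OF \<nu> alt_height_in_null_space int(1)])
  moreover have "\<forall>\<^sub>F n in sequentially.
      (LINT x|\<nu>. alt_height n x) / real n - (LINT x|\<nu>. D_fun m x)
        = (LINT x|\<nu>. Phi lam m n x) / real n"
    using eventually_gt_at_top[of 0]
    by eventually_elim
      (use int in \<open>simp add: Phi_eq integral_birkhoff_D_fun[OF lam \<nu>] diff_divide_distrib\<close>)
  ultimately have "(\<lambda>n. (LINT x|\<nu>. Phi lam m n x) / real n) \<longlonglongrightarrow> 0 - (LINT x|\<nu>. D_fun m x)"
    by (rule Lim_transform_eventually)
  moreover have "(\<lambda>n. (LINT x|\<nu>. Phi lam m n x) / real n) \<longlonglongrightarrow> E_eval (E_class lam (Phi lam m)) \<nu>"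
    by (rule E_eval_tendsto[OF lam E_class_in_E_orb in_E_class \<nu>]) (rule Phi_in_AA_orb[OF lam])+
  ultimately show ?thesis using LIMSEQ_unique by fastforce
qed

text \<open>With \<open>(T lam ^^ k) y = z\<close>, the value of \<open>\<Psi> (n + k)\<close> at
  \<open>y\<close> is split at time \<open>n\<close> and at time \<open>k\<close>. Comparison leaves
  two defects and the variation of \<open>\<Psi> k\<close>, bounded independently of
  \<open>n\<close> because \<open>k \<le> Suc m\<close>.\<close>

lemma AA_orb_oscillation_on_Z:
  assumes lam: "0 < lam" "lam < 1" and "\<Psi> \<in> AA_orb lam"
  obtains C where "\<And>n y z. 1 \<le> n \<Longrightarrow> y \<in> Z m \<Longrightarrow> z \<in> Z m \<Longrightarrow> \<Psi> n z \<le> \<Psi> n y + C"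
proof -
  obtain C where C: "0 \<le> C" "\<And>n k x. 1 \<le> n \<Longrightarrow> 1 \<le> k \<Longrightarrow>
      \<bar>\<Psi> (n + k) x - \<Psi> n x - \<Psi> k ((T lam ^^ n) x)\<bar> \<le> C"
    by (fact AA_orb_defectE[OF assms(3)])
  obtain L where L: "0 \<le> L" "\<And>n x y. 1 \<le> n \<Longrightarrow>
      \<bar>\<Psi> n x - \<Psi> n y\<bar> \<le> L * (\<Sum>j<n. dist ((T lam ^^ j) x) ((T lam ^^ j) y))"
    by (fact AA_orb_lipschitzE[OF assms(3)])
  have "\<Psi> n z \<le> \<Psi> n y + (2 * C + L * (2 * Suc m))" if n: "1 \<le> n" and yz: "y \<in> Z m" "z \<in> Z m" for n y z
  proof -
    obtain k where k: "1 \<le> k" "k \<le> Suc m" "(T lam ^^ k) y = z"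
      by (rule T_transitive_Z[OF lam yz])
    have "\<Psi> k ((T lam ^^ n) y) - \<Psi> k y
        \<le> L * (\<Sum>j<k. dist ((T lam ^^ j) ((T lam ^^ n) y)) ((T lam ^^ j) y))"
      using L(2)[OF k(1), of "(T lam ^^ n) y" y] by linarith
    also have "\<dots> \<le> L * (\<Sum>j<k. 2)"
      using L(1) by (intro mult_left_mono sum_mono dist_xpt_le_2)
    also have "\<dots> \<le> L * (2 * Suc m)"
      using L(1) k(2) by (intro mult_left_mono) auto
    finally have "\<Psi> k ((T lam ^^ n) y) - \<Psi> k y \<le> L * (2 * Suc m)" .
    moreover have "\<bar>\<Psi> (n + k) y - \<Psi> n y - \<Psi> k ((T lam ^^ n) y)\<bar> \<le> C"
      "\<bar>\<Psi> (n + k) y - \<Psi> k y - \<Psi> n z\<bar> \<le> C"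
      using C(2)[OF n k(1), of y] C(2)[OF k(1) n, of y] k(3) by (simp_all add: add.commute)
    ultimately show ?thesis by linarith
  qed
  then show ?thesis by (rule that)
qed

text \<open>Relative to \<open>mu m\<close>, the class of \<open>Phi\<close> loses the full integral
  of \<open>D_fun m\<close>, and the perturbation \<open>\<Psi> - \<Phi>\<close> regains at most the
  fraction \<open>L\<close> of it.\<close>

lemma E_eval_gap:
  assumes lam: "0 < lam" "lam < 1"
    and \<eta>: "\<eta> \<in> E_orb lam" "\<Psi> \<in> \<eta>" and \<Phi>: "\<Phi> \<in> E_class lam (Phi lam m)"
    and L: "\<And>n x y. 1 \<le> n \<Longrightarrow> \<bar>(\<Psi> - \<Phi>) n x - (\<Psi> - \<Phi>) n y\<bar>
      \<le> L * (\<Sum>j<n. dist ((T lam ^^ j) x) ((T lam ^^ j) y))" "0 \<le> L"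
    and \<nu>: "\<nu> \<in> inv_measures lam"
  shows "E_eval \<eta> \<nu> \<le> E_eval \<eta> (mu m) - (1 - L) * (LINT x|\<nu>. D_fun m x)"
proof -
  have PhiE: "E_class lam (Phi lam m) \<in> E_orb lam"
    by (intro E_class_in_E_orb Phi_in_AA_orb lam)
  have AA: "\<Psi> \<in> AA_orb lam" "\<Phi> \<in> AA_orb lam"
    using E_orbD(1) \<eta> PhiE \<Phi> by blast+
  define \<Theta> where "\<Theta> = \<Psi> - \<Phi>"
  have \<Theta>: "\<Theta> \<in> AA_orb lam" unfolding \<Theta>_def using AA by (rule AA_orb_diff)
  note \<mu> = mu_in_inv_measures[OF lam, of m]
  interpret \<nu>: prob_space \<nu> using inv_measuresD(1)[OF \<nu>] .
  interpret \<mu>: prob_space "mu m" by (rule prob_space_mu)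
  obtain C where C: "\<And>n y z. 1 \<le> n \<Longrightarrow> y \<in> Z m \<Longrightarrow> z \<in> Z m \<Longrightarrow> \<Theta> n z \<le> \<Theta> n y + C"
    by (fact AA_orb_oscillation_on_Z[OF lam \<Theta>])
  define d where "d = (LINT x|\<nu>. D_fun m x)"
  have \<Theta>_le: "(LINT x|\<nu>. \<Theta> n x) \<le> (LINT x|mu m. \<Theta> n x) + C + L * (real n * d)" if n: "1 \<le> n" for n
  proof -
    have "\<Theta> n x \<le> (LINT x|mu m. \<Theta> n x) + C + L * birkhoff lam (D_fun m) n x" for x
    proof -
      obtain y where y: "y \<in> Z m" "\<And>n. (\<Sum>j<n. dist ((T lam ^^ j) x) ((T lam ^^ j) y))
          \<le> birkhoff lam (D_fun m) n x"
        by (fact shadowing_point[OF lam])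
      \<comment> \<open>The shadowing point \<open>y\<close> varies with \<open>x\<close>; bounding
        its value by the mean over \<open>Z m\<close> plus \<open>C\<close> leaves a bound that can
        be integrated in \<open>x\<close>.\<close>
      have "\<Theta> n y - C \<le> (LINT x|mu m. \<Theta> n x)"
        using AE_mu_in_Z[of m] C[OF n _ y(1)] AA_orb_integrable[OF \<Theta> \<mu>]
        by (intro \<mu>.integral_ge_const) (auto elim!: eventually_mono simp: diff_le_eq)
      moreover have "\<Theta> n x \<le> \<Theta> n y + L * birkhoff lam (D_fun m) n x"
        using L(1)[OF n, of x y] mult_left_mono[OF y(2)[of n] L(2)] unfolding \<Theta>_def by linarith
      ultimately show ?thesis by linarith
    qed
    then have "(LINT x|\<nu>. \<Theta> n x)
        \<le> (LINT x|\<nu>. (LINT x|mu m. \<Theta> n x) + C + L * birkhoff lam (D_fun m) n x)"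
      using AA_orb_integrable[OF \<Theta> \<nu>] AA_orb_integrable[OF birkhoff_D_fun_in_AA_orb[OF lam] \<nu>]
      by (intro integral_mono) auto
    also have "\<dots> = (LINT x|mu m. \<Theta> n x) + C + L * (real n * d)"
      using AA_orb_integrable[OF birkhoff_D_fun_in_AA_orb[OF lam] \<nu>]
      by (simp add: integral_birkhoff_D_fun[OF lam \<nu>] d_def \<nu>.prob_space)
    finally show ?thesis .
  qed
  have split: "(LINT x|\<rho>. \<Psi> n x) = (LINT x|\<rho>. \<Phi> n x) + (LINT x|\<rho>. \<Theta> n x)"
    if "\<rho> \<in> inv_measures lam" for \<rho> n
    using AA_orb_integrable[OF AA(1) that, of n] AA_orb_integrable[OF AA(2) that, of n]
    by (simp add: \<Theta>_def)
  let ?I = "\<lambda>\<Psi> \<rho> n. (LINT x|\<rho>. \<Psi> n x) / real n"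
  \<comment> \<open>After division by \<open>n\<close> the oscillation constant contributes only
    \<open>C / n\<close>, which vanishes in the limit.\<close>
  have "\<forall>\<^sub>F n in sequentially. ?I \<Psi> \<nu> n \<le> ?I \<Psi> (mu m) n + ?I \<Phi> \<nu> n - ?I \<Phi> (mu m) n + C / real n + L * d"
    using eventually_ge_at_top[of 1]
  proof eventually_elim
    case (elim n)
    have "(LINT x|\<nu>. \<Psi> n x) \<le> (LINT x|mu m. \<Psi> n x) + (LINT x|\<nu>. \<Phi> n x) - (LINT x|mu m. \<Phi> n x)
        + C + L * d * real n"
      using \<Theta>_le[OF elim] unfolding split[OF \<nu>] split[OF \<mu>] by (simp add: ac_simps)
    from divide_right_mono[OF this, of "real n"] show ?case
      using elim by (simp add: add_divide_distrib diff_divide_distrib)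
  qed
  moreover have "(\<lambda>n. ?I \<Psi> (mu m) n + ?I \<Phi> \<nu> n - ?I \<Phi> (mu m) n + C / real n + L * d) \<longlonglongrightarrow>
      E_eval \<eta> (mu m) + E_eval (E_class lam (Phi lam m)) \<nu> - E_eval (E_class lam (Phi lam m)) (mu m)
        + 0 + L * d"
    by (intro tendsto_add tendsto_diff tendsto_const lim_const_over_n
        E_eval_tendsto[OF lam] \<eta> \<Phi> PhiE \<nu> \<mu>)
  moreover have "?I \<Psi> \<nu> \<longlonglongrightarrow> E_eval \<eta> \<nu>" by (rule E_eval_tendsto[OF lam \<eta> \<nu>])
  ultimately have "E_eval \<eta> \<nu> \<le> E_eval \<eta> (mu m) + E_eval (E_class lam (Phi lam m)) \<nu>
      - E_eval (E_class lam (Phi lam m)) (mu m) + 0 + L * d"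
    by (intro tendsto_le[OF sequentially_bot])
  moreover have "(LINT x|mu m. D_fun m x) = 0"
    using AE_mu_in_Z[of m] by (intro integral_eq_zero_AE) (simp add: D_fun_eq_0_iff)
  ultimately show ?thesis
    by (simp add: E_eval_E_class_Phi[OF lam] \<nu> \<mu> d_def algebra_simps)
qed

text \<open>With constant below 1 the gap is strict unless the integral of \<open>D_fun m\<close>
  vanishes, that is, unless \<open>\<nu>\<close> is carried by \<open>Z m\<close>. Free
  representatives let this cover both the centre of the ball and its other elements.\<close>

lemma M_max_eq:
  assumes lam: "0 < lam" "lam < 1"
    and \<eta>: "\<eta> \<in> E_orb lam" "\<Psi> \<in> \<eta>" and \<Phi>: "\<Phi> \<in> E_class lam (Phi lam m)"
    and L: "L_orb lam (\<Psi> - \<Phi>) < 1"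
  shows "M_max lam \<eta> = {mu m}"
proof -
  obtain l where l: "0 \<le> l" "L_orb lam (\<Psi> - \<Phi>) = ennreal l"
    using L by (cases "L_orb lam (\<Psi> - \<Phi>)") auto
  then have l1: "l < 1" using L by (simp add: ennreal_less_one_iff)
  have gap: "E_eval \<eta> \<nu> \<le> E_eval \<eta> (mu m) - (1 - l) * (LINT x|\<nu>. D_fun m x)"
    if "\<nu> \<in> inv_measures lam" for \<nu>
    using L_orb_le_iff[OF l(1), of lam "\<Psi> - \<Phi>"] l that by (intro E_eval_gap[OF lam \<eta> \<Phi>]) auto
  have D: "0 \<le> (LINT x|\<nu>. D_fun m x)" for \<nu>
    by (intro integral_nonneg_AE) (simp add: D_fun_nonneg)
  note \<mu> = mu_in_inv_measures[OF lam, of m]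
  show ?thesis
  proof (intro equalityI subsetI)
    fix \<nu> assume "\<nu> \<in> {mu m}"
    moreover have "E_eval \<eta> \<nu>' \<le> E_eval \<eta> (mu m)" if "\<nu>' \<in> inv_measures lam" for \<nu>'
    proof -
      have "0 \<le> (1 - l) * (LINT x|\<nu>'. D_fun m x)" using l1 D by simp
      with gap[OF that] show ?thesis by linarith
    qed
    ultimately show "\<nu> \<in> M_max lam \<eta>" using \<mu> by (simp add: M_max_def)
  next
    fix \<nu> assume "\<nu> \<in> M_max lam \<eta>"
    then have \<nu>: "\<nu> \<in> inv_measures lam" and "E_eval \<eta> (mu m) \<le> E_eval \<eta> \<nu>"
      using \<mu> by (auto simp: M_max_def)
    with gap[OF \<nu>] have "(1 - l) * (LINT x|\<nu>. D_fun m x) \<le> 0" by simp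
    then have "(LINT x|\<nu>. D_fun m x) = 0"
      using l1 D[of \<nu>] by (simp add: mult_le_0_iff)
    then have "AE x in \<nu>. D_fun m x = 0"
      using integral_nonneg_eq_0_iff_AE[OF integrable_D_fun[OF lam \<nu>]] by (simp add: D_fun_nonneg)
    then show "\<nu> \<in> {mu m}"
      using inv_measure_eq_mu[OF lam \<nu>] by (simp add: D_fun_eq_0_iff)
  qed
qed

theorem proposition5p12:
  fixes lam :: real and m :: nat
  assumes "0 < lam" and "lam < 1"
  shows "Phi lam m \<in> AA_orb lam
    \<and> defect lam (Phi lam m) < \<infinity>
    \<and> L_orb lam (Phi lam m) < \<infinity>
    \<and> \<not> (\<forall>n\<ge>1. \<forall>s\<ge>1. \<forall>x.
          Phi lam m (n + s) x = Phi lam m n x + Phi lam m s ((T lam ^^ n) x))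
    \<and> E_class lam (Phi lam m) = E_uminus (E_class lam (birkhoff lam (D_fun m)))
    \<and> M_max lam (E_class lam (Phi lam m)) = {mu m}
    \<and> E_ball lam (E_class lam (Phi lam m)) 1 \<subseteq> {\<eta> \<in> E_orb lam. M_max lam \<eta> = {mu m}}"
proof (intro conjI)
  show Phi: "Phi lam m \<in> AA_orb lam" by (rule Phi_in_AA_orb[OF assms])
  then show "defect lam (Phi lam m) < \<infinity>" "L_orb lam (Phi lam m) < \<infinity>"
    by (simp_all add: AA_orb_def)
  show "\<not> (\<forall>n\<ge>1. \<forall>s\<ge>1. \<forall>x.
      Phi lam m (n + s) x = Phi lam m n x + Phi lam m s ((T lam ^^ n) x))"
    using Phi_not_additive[OF assms] by blast
  show "E_class lam (Phi lam m) = E_uminus (E_class lam (birkhoff lam (D_fun m)))"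
    by (rule E_class_Phi[OF assms])
  \<comment> \<open>For the centre of the ball both representatives are \<open>Phi lam m\<close>,
    with difference zero.\<close>
  have "L_orb lam (Phi lam m - Phi lam m) \<le> ennreal 0"
    by (subst L_orb_le_iff) simp_all
  then show "M_max lam (E_class lam (Phi lam m)) = {mu m}"
    using Phi by (intro M_max_eq[OF assms E_class_in_E_orb in_E_class in_E_class]) simp_all
  show "E_ball lam (E_class lam (Phi lam m)) 1 \<subseteq> {\<eta> \<in> E_orb lam. M_max lam \<eta> = {mu m}}"
  proof
    fix \<eta> assume "\<eta> \<in> E_ball lam (E_class lam (Phi lam m)) 1"
    then have \<eta>: "\<eta> \<in> E_orb lam" and "E_norm lam (E_minus \<eta> (E_class lam (Phi lam m))) < 1"
      by (simp_all add: E_ball_def)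
    \<comment> \<open>The quotient norm is an infimum, so a value below 1 is witnessed by a single
      pair of representatives.\<close>
    then obtain \<Psi> \<Phi> where \<Psi>: "\<Psi> \<in> \<eta>" "\<Phi> \<in> E_class lam (Phi lam m)" "AA_norm lam (\<Psi> - \<Phi>) < 1"
      by (auto simp: E_norm_def E_minus_def INF_less_iff)
    have "L_orb lam (\<Psi> - \<Phi>) \<le> AA_norm lam (\<Psi> - \<Phi>)"
      by (simp add: AA_norm_def add_increasing)
    then show "\<eta> \<in> {\<eta> \<in> E_orb lam. M_max lam \<eta> = {mu m}}"
      using M_max_eq[OF assms \<eta> \<Psi>(1,2)] \<Psi>(3) \<eta> by simp
  qed
qed

end
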